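(* Let $A,B\in M_n$ be positive definite matrices. Then: (1) $s\big(A^t(A\sharp_tB)B^{1-t}\big)\prec_{\log}s\big(A^{\frac32}BA^{-\frac12}\big)$ for all $\frac12\le t\le1$; (2) $s\big(A^t(A\sharp_tB)B^{1-t}\big)\prec_{\log}s\big(B^{\frac32}AB^{-\frac12}\big)$ for all $0\le t\le\frac12$.
   Context: $M_n$ is the space of $n\times n$ complex matrices. For $X\in M_n$, $s(X)=(s_1(X),\dots,s_n(X))^t$ is the vector of singular values of $X$ (eigenvalues of $(X^*X)^{1/2}$) in decreasing order. For vectors $x,y\in\mathbb{R}^n$ with nonnegative entries in decreasing order, $x\prec_{\log}y$ means $\prod_{i=1}^k x_i\le\prod_{i=1}^k y_i$ for $k=1,\dots,n-1$ and $\prod_{i=1}^n x_i=\prod_{i=1}^n y_i$. For positive definite $A,B$ and $0\le t\le1$, the weighted geometric mean is $A\sharp_tB=A^{\frac12}(A^{-\frac12}BA^{-\frac12})^tA^{\frac12}$. *)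

theory Defs
  imports "Jordan_Normal_Form.Schur_Decomposition"
begin

definition positive_definite :: "nat \<Rightarrow> complex mat \<Rightarrow> bool" where
  "positive_definite n A \<longleftrightarrow>
     A \<in> carrier_mat n n \<and> mat_adjoint A = A \<and>
     (\<forall>v \<in> carrier_vec n. v \<noteq> 0\<^sub>v n \<longrightarrow> Re ((A *\<^sub>v v) \<bullet>c v) > 0)"

definition unitary_mat :: "nat \<Rightarrow> complex mat \<Rightarrow> bool" where
  "unitary_mat n U \<longleftrightarrow> U \<in> carrier_mat n n \<and> mat_adjoint U * U = 1\<^sub>m n"

definition spectral_form :: "nat \<Rightarrow> complex mat \<Rightarrow> (nat \<Rightarrow> real) \<Rightarrow> complex mat" where
  "spectral_form n U d = U * mat_diag n (\<lambda>i. complex_of_real (d i)) * mat_adjoint U"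

text \<open>Real powers by functional calculus: if \<open>A = U diag(d) U\<^sup>*\<close> with \<open>U\<close> unitary and \<open>d\<close> real,
  then \<open>A\<^sup>t = U diag(d\<^sup>t) U\<^sup>*\<close>. The result does not depend on the decomposition
  (lemma \<open>mat_powr_spectral_form\<close> below). Since \<open>0 powr 0 = 0\<close>, the power \<open>t = 0\<close> of a singular
  matrix is not the identity; it is the identity for positive definite matrices.\<close>

definition mat_powr :: "complex mat \<Rightarrow> real \<Rightarrow> complex mat" where
  "mat_powr A t = (THE P. \<exists>U d. unitary_mat (dim_row A) U \<and> A = spectral_form (dim_row A) U d \<and>
     P = spectral_form (dim_row A) U (\<lambda>i. d i powr t))"

definition geometric_mean :: "real \<Rightarrow> complex mat \<Rightarrow> complex mat \<Rightarrow> complex mat" where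
  "geometric_mean t A B =
     mat_powr A (1/2) * mat_powr (mat_powr A (-1/2) * B * mat_powr A (-1/2)) t * mat_powr A (1/2)"

text \<open>The eigenvalues of \<open>(X\<^sup>*X)\<^bsup>1/2\<^esup>\<close>, with algebraic multiplicity and in decreasing order.
  They are nonnegative reals, so taking real parts loses nothing.\<close>

definition singular_values :: "complex mat \<Rightarrow> real list" where
  "singular_values X = rev (sorted_list_of_multiset
     (image_mset Re (proots (char_poly (mat_powr (mat_adjoint X * X) (1/2))))))"

text \<open>Only meant for lists of nonnegative reals in decreasing order.\<close>

definition log_majorized :: "real list \<Rightarrow> real list \<Rightarrow> bool"  (infix \<open>\<prec>\<^sub>l\<^sub>o\<^sub>g\<close> 50) where
  "x \<prec>\<^sub>l\<^sub>o\<^sub>g y \<longleftrightarrow>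
     length x = length y \<and>
     (\<forall>k \<in> {1..<length x}. (\<Prod>i<k. x ! i) \<le> (\<Prod>i<k. y ! i)) \<and>
     (\<Prod>i<length x. x ! i) = (\<Prod>i<length y. y ! i)"


lemma mat_adjoint_carrier:
  "U \<in> carrier_mat n n \<Longrightarrow> mat_adjoint (U :: complex mat) \<in> carrier_mat n n"
  unfolding mat_adjoint_def carrier_mat_def by auto

lemma unitary_matD:
  assumes "unitary_mat n U"
  shows "U \<in> carrier_mat n n" "mat_adjoint U \<in> carrier_mat n n"
    "mat_adjoint U * U = 1\<^sub>m n" "U * mat_adjoint U = 1\<^sub>m n"
  using assms mat_adjoint_carrier mat_mult_left_right_inverse
  unfolding unitary_mat_def by blast+

lemma spectral_form_carrier:
  assumes "unitary_mat n U"
  shows "spectral_form n U d \<in> carrier_mat n n"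
  unfolding spectral_form_def using unitary_matD[OF assms] mat_diag_dim
  by (meson mult_carrier_mat)

lemma spectral_form_eqD:
  assumes U: "unitary_mat n U" and V: "unitary_mat n V"
    and eq: "spectral_form n U d = spectral_form n V e"
  shows "spectral_form n U (\<lambda>i. f (d i)) = spectral_form n V (\<lambda>i. f (e i))"
proof -
  define W where "W = mat_adjoint V * U"
  note u = unitary_matD[OF U] and v = unitary_matD[OF V]
  have W: "W \<in> carrier_mat n n" unfolding W_def using u v by simp
  have assoc_square: "(X * Y) * Z = X * (Y * Z)"
    if "X \<in> carrier_mat n n" "Y \<in> carrier_mat n n" "Z \<in> carrier_mat n n" for X Y Z :: "complex mat"
    using assoc_mult_mat that by blast
  have conj: "mat_adjoint V * spectral_form n U g * U = W * mat_diag n (\<lambda>i. complex_of_real (g i))" for g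
  proof -
    let ?D = "mat_diag n (\<lambda>i. complex_of_real (g i))"
    have D: "?D \<in> carrier_mat n n" by simp
    have "mat_adjoint V * spectral_form n U g * U = W * ?D * (mat_adjoint U * U)"
      unfolding spectral_form_def W_def using u(1,2) v(1,2) D
      by (simp add: assoc_square mult_carrier_mat[where n = n])
    then show ?thesis using u(3) W D by simp
  qed
  have conj': "mat_adjoint V * spectral_form n V g * U = mat_diag n (\<lambda>i. complex_of_real (g i)) * W" for g
  proof -
    let ?D = "mat_diag n (\<lambda>i. complex_of_real (g i))"
    have D: "?D \<in> carrier_mat n n" by simp
    have "mat_adjoint V * spectral_form n V g * U = (mat_adjoint V * V) * (?D * W)"
      unfolding spectral_form_def W_def using u(1,2) v(1,2) D
      by (simp add: assoc_square mult_carrier_mat[where n = n])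
    then show ?thesis using v(3) W D by simp
  qed
  have "W $$ (i,j) * complex_of_real (d j) = complex_of_real (e i) * W $$ (i,j)"
    if "i < n" "j < n" for i j
  proof -
    have "W * mat_diag n (\<lambda>i. complex_of_real (d i)) = mat_diag n (\<lambda>i. complex_of_real (e i)) * W"
      using conj[of d] conj'[of e] eq by simp
    then have "(W * mat_diag n (\<lambda>i. complex_of_real (d i))) $$ (i,j) =
      (mat_diag n (\<lambda>i. complex_of_real (e i)) * W) $$ (i,j)" by simp
    then show ?thesis
      unfolding mat_diag_mult_left[OF W] mat_diag_mult_right[OF W] using that by simp
  qed
  then have "W $$ (i,j) = 0 \<or> d j = e i" if "i < n" "j < n" for i j
    using that by (metis mult.commute mult_cancel_left of_real_eq_iff)
  then have "W * mat_diag n (\<lambda>i. complex_of_real (f (d i))) =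
    mat_diag n (\<lambda>i. complex_of_real (f (e i))) * W"
    unfolding mat_diag_mult_left[OF W] mat_diag_mult_right[OF W]
    by (intro eq_matI) force+
  then have *: "mat_adjoint V * spectral_form n U (\<lambda>i. f (d i)) * U =
    mat_adjoint V * spectral_form n V (\<lambda>i. f (e i)) * U"
    unfolding conj conj' .
  have cancel: "V * (mat_adjoint V * S * U) * mat_adjoint U = S" if S: "S \<in> carrier_mat n n" for S
  proof -
    have "V * (mat_adjoint V * S * U) * mat_adjoint U =
        (V * mat_adjoint V) * (S * (U * mat_adjoint U))"
      using u(1,2) v(1,2) S
      by (simp add: assoc_square mult_carrier_mat[where n = n])
    then show ?thesis using u(4) v(4) S by simp
  qed
  show ?thesis
    using cancel[OF spectral_form_carrier[OF U]] cancel[OF spectral_form_carrier[OF V]] *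
    by metis
qed

lemma mat_powr_spectral_form:
  assumes U: "unitary_mat n U"
  shows "mat_powr (spectral_form n U d) t = spectral_form n U (\<lambda>i. d i powr t)"
proof -
  have n: "dim_row (spectral_form n U d) = n"
    using spectral_form_carrier[OF U] by (rule carrier_matD)
  show ?thesis
    unfolding mat_powr_def n
  proof (rule the_equality)
    show "\<exists>V e. unitary_mat n V \<and> spectral_form n U d = spectral_form n V e \<and>
        spectral_form n U (\<lambda>i. d i powr t) = spectral_form n V (\<lambda>i. e i powr t)"
      using U by blast
  next
    fix P
    assume "\<exists>V e. unitary_mat n V \<and> spectral_form n U d = spectral_form n V e \<and>
        P = spectral_form n V (\<lambda>i. e i powr t)"
    then show "P = spectral_form n U (\<lambda>i. d i powr t)"
      using spectral_form_eqD[OF U, of _ d _ "\<lambda>x. x powr t"] by metis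
  qed
qed

end

theory Submission
  imports Defs
begin

text \<open>
  Write \<open>N\<^sub>k(X)\<close> for the product of the \<open>k\<close> largest singular values of \<open>X\<close>. Log-majorization of the
  singular values of \<open>X\<close> by those of \<open>Y\<close> means \<open>N\<^sub>k(X) \<le> N\<^sub>k(Y)\<close> for \<open>k < n\<close> together with
  \<open>\<bar>det X\<bar> = \<bar>det Y\<bar>\<close>. Both sides of the claim have determinant \<open>det A det B\<close>, so the inequalities
  for \<open>N\<^sub>k\<close> are the substance.

  Let \<open>C = A\<^bsup>-1/2\<^esup> B A\<^bsup>-1/2\<^esup>\<close>. Then \<open>B = A\<^bsup>1/2\<^esup> C A\<^bsup>1/2\<^esup>\<close>, and the matrix on the right of the claim for
  \<open>1/2 \<le> t \<le> 1\<close> is \<open>A\<^bsup>3/2\<^esup> B A\<^bsup>-1/2\<^esup> = A\<^sup>2 C\<close>. With \<open>a = (t + 1/2)/2\<close> and \<open>b = (t - 1/2)/2\<close>, so that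
  \<open>a + b = t\<close>, the matrix on the left factors as
  \<open>(A\<^bsup>2a\<^esup> C\<^sup>a) (C\<^sup>b A\<^bsup>2b\<^esup>) (A\<^bsup>1-t\<^esup> B\<^bsup>1-t\<^esup>)\<close>.
  Put \<open>y = N\<^sub>k(A\<^sup>2 C)\<close>. Two properties of \<open>N\<^sub>k\<close> finish the proof: it is submultiplicative (Horn), and
  \<open>N\<^sub>k(P\<^sup>s Q\<^sup>s) \<le> N\<^sub>k(P Q)\<^sup>s\<close> for positive definite \<open>P\<close>, \<open>Q\<close> and \<open>0 \<le> s \<le> 1\<close> (Cordes, Araki).
  The second one bounds the first two factors by \<open>y\<^sup>a\<close> and \<open>y\<^sup>b\<close>. For the third,
  \<open>A\<^bsup>1/2\<^esup> B A\<^bsup>1/2\<^esup> = A C A\<close> gives \<open>N\<^sub>k(A\<^bsup>1/2\<^esup> B\<^bsup>1/2\<^esup>) = N\<^sub>k(A C\<^bsup>1/2\<^esup>) \<le> y\<^bsup>1/2\<^esup>\<close>, and the exponent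
  \<open>2(1 - t)\<close>, which lies in \<open>[0,1]\<close> exactly because \<open>t \<ge> 1/2\<close>, then gives \<open>y\<^bsup>1-t\<^esup>\<close>. The exponents add
  up to \<open>1\<close>. The range \<open>t \<le> 1/2\<close> follows by taking adjoints and using
  \<open>A \<sharp>\<^sub>t B = B \<sharp>\<^bsub>1-t\<^esub> A\<close>.

  Horn's inequality rests on \<open>det ((XV)\<^sup>* (XV)) \<le> N\<^sub>k(X)\<^sup>2 det (V\<^sup>* V)\<close> for every \<open>n \<times> k\<close> matrix \<open>V\<close>, with
  equality when the columns of \<open>V\<close> are top eigenvectors of \<open>X\<^sup>* X\<close>; this is a Cauchy--Binet expansion
  in an eigenbasis. The Cordes inequality follows from Horn's alone: if \<open>PQ\<close> is positive
  semidefinite then \<open>N\<^sub>k(PQ) \<le> N\<^sub>k(QP)\<close>, because the powers of \<open>PQ\<close> and of \<open>QP\<close> differ by a bounded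
  number of factors. Hence \<open>s \<mapsto> N\<^sub>k(P\<^sup>s Q\<^sup>s)\<close> is midpoint log-convex, it equals \<open>1\<close> at \<open>s = 0\<close>, and
  it is bounded on \<open>[0,1]\<close>; such a function lies below its chord.
\<close>

section \<open>Adjoints and the spectral theorem\<close>

lemma mat_adjoint_dim [simp]:
  "dim_row (mat_adjoint A) = dim_col A" "dim_col (mat_adjoint A) = dim_row A"
  unfolding mat_adjoint_def by auto

lemma mat_adjoint_index [simp]:
  fixes A :: "complex mat"
  assumes "i < dim_col A" "j < dim_row A"
  shows "mat_adjoint A $$ (i,j) = cnj (A $$ (j,i))"
proof -
  have "mat_adjoint A $$ (i,j) = map conjugate (cols A) ! i $ j"
    unfolding mat_adjoint_def using assms by (intro mat_of_rows_index) auto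
  then show ?thesis using assms by simp
qed

lemma mat_adjoint_carrier_rect:
  "A \<in> carrier_mat n m \<Longrightarrow> mat_adjoint (A :: complex mat) \<in> carrier_mat m n"
  by (intro carrier_matI) auto

lemma mat_assoc_square:
  fixes X Y Z :: "complex mat"
  assumes "X \<in> carrier_mat n n" "Y \<in> carrier_mat n n" "Z \<in> carrier_mat n n"
  shows "(X * Y) * Z = X * (Y * Z)"
  using assms by (rule assoc_mult_mat)

lemma mat_adjoint_adjoint [simp]: "mat_adjoint (mat_adjoint A) = (A :: complex mat)"
  by (rule eq_matI) auto

lemma mat_adjoint_mult:
  fixes A B :: "complex mat"
  assumes "A \<in> carrier_mat n m" "B \<in> carrier_mat m k"
  shows "mat_adjoint (A * B) = mat_adjoint B * mat_adjoint A"
  using assms by (intro eq_matI) (auto simp: scalar_prod_def intro!: sum.cong)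

lemma mat_adjoint_one [simp]: "mat_adjoint (1\<^sub>m n) = (1\<^sub>m n :: complex mat)"
  by (rule eq_matI) auto

lemma mat_adjoint_real_diag:
  "mat_adjoint (mat_diag n (\<lambda>i. complex_of_real (d i))) = mat_diag n (\<lambda>i. complex_of_real (d i))"
  by (rule eq_matI) (auto simp: mat_diag_def)

lemma unitary_mat_mult:
  assumes "unitary_mat n U" "unitary_mat n V"
  shows "unitary_mat n (U * V)"
proof -
  note u = unitary_matD[OF assms(1)] and v = unitary_matD[OF assms(2)]
  have "mat_adjoint (U * V) * (U * V) = mat_adjoint V * ((mat_adjoint U * U) * V)"
    unfolding mat_adjoint_mult[OF u(1) v(1)]
    using u(1,2) v(1,2) by (simp add: mat_assoc_square[where n=n] mult_carrier_mat[where n=n])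
  then show ?thesis unfolding unitary_mat_def using u v by auto
qed

lemma spectral_form_index:
  assumes "unitary_mat n U" "i < n" "j < n"
  shows "spectral_form n U d $$ (i,j) = (\<Sum>k<n. U $$ (i,k) * complex_of_real (d k) * cnj (U $$ (j,k)))"
proof -
  note u = unitary_matD[OF assms(1)]
  show ?thesis
    unfolding spectral_form_def mat_diag_mult_right[OF u(1)]
    using u(1) assms by (auto simp: scalar_prod_def lessThan_atLeast0)
qed

lemma spectral_form_conjugate:
  assumes "unitary_mat n U" "unitary_mat n V"
  shows "spectral_form n (U * V) d = U * spectral_form n V d * mat_adjoint U"
proof -
  note u = unitary_matD[OF assms(1)] and v = unitary_matD[OF assms(2)]
  show ?thesis
    unfolding spectral_form_def mat_adjoint_mult[OF u(1) v(1)]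
    using u(1,2) v(1,2)
    by (simp add: mat_assoc_square[where n=n] mult_carrier_mat[where n=n])
qed

text \<open>Gram--Schmidt, applied to a basis that starts with \<open>v\<close>, yields orthogonal columns; rescaling them
  makes the matrix unitary and keeps the direction of the first column.\<close>

lemma unitary_extension:
  assumes v: "v \<in> carrier_vec n" and v0: "v \<noteq> 0\<^sub>v n"
  obtains U c where "unitary_mat n U" "col U 0 = c \<cdot>\<^sub>v v"
proof -
  interpret cof_vec_space n "TYPE(complex)" .
  define b where "b = basis_completion v"
  define ws where "ws = gram_schmidt n b"
  define W where "W = mat_of_cols n ws"
  from basis_completion[OF v v0, folded b_def]
  have span_b: "span (set b) = carrier_vec n" and dist_b: "distinct b" 
    and indep: "\<not> lin_dep (set b)" and b: "set b \<subseteq> carrier_vec n" and hdb: "hd b = v" 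
    and len_b: "length b = n" by auto
  have n: "n > 0" using v v0 by (cases n) auto
  from hdb len_b n obtain vs where bv: "b = v # vs" by (cases b, auto)
  from gram_schmidt_result[OF b dist_b indep refl, folded ws_def]
  have ws: "set ws \<subseteq> carrier_vec n" "corthogonal ws" "length ws = n" 
    by (auto simp: len_b)
  from gram_schmidt_hd[OF v, of vs, folded bv] have hdws: "hd ws = v" unfolding ws_def .
  have orth: "corthogonal_mat W" using orthogonal_mat_of_cols ws unfolding W_def .
  have W: "W \<in> carrier_mat n n"
    using ws unfolding W_def using mat_of_cols_carrier(1)[of n ws] by auto
  have W0: "col W 0 = v"
    unfolding W_def using hdws ws n by (subst col_mat_of_cols) (auto simp: hd_conv_nth)
  define r where "r j = (\<Sum>k<n. (cmod (W $$ (k,j)))\<^sup>2)" for j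
  define c where "c j = 1 / sqrt (r j)" for j
  define U where "U = W * mat_diag n (\<lambda>j. complex_of_real (c j))"
  have U: "U \<in> carrier_mat n n" unfolding U_def using W by auto
  have Uind: "U $$ (i,j) = W $$ (i,j) * c j" if "i < n" "j < n" for i j
    unfolding U_def mat_diag_mult_right[OF W] using that by simp
  have gram: "(\<Sum>k<n. cnj (W $$ (k,i)) * W $$ (k,j)) = (if i = j then of_real (r i) else 0)"
    if ij: "i < n" "j < n" for i j
  proof (cases "i = j")
    case True
    then show ?thesis by (simp add: r_def mult.commute complex_norm_square[symmetric] del: of_real_power)
  next
    case False
    have "(col W j \<bullet>c col W i) = 0" using corthogonal_matD[OF orth, of j i] ij W False by auto
    moreover have "(col W j \<bullet>c col W i) = (\<Sum>k<n. cnj (W $$ (k,i)) * W $$ (k,j))"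
      using W ij by (auto simp: scalar_prod_def lessThan_atLeast0 intro!: sum.cong)
    ultimately show ?thesis using False by simp
  qed
  have rpos: "r i > 0" if i: "i < n" for i
  proof -
    have "(col W i \<bullet>c col W i) \<noteq> 0" using corthogonal_matD[OF orth, of i i] i W by auto
    moreover have "(col W i \<bullet>c col W i) = (\<Sum>k<n. cnj (W $$ (k,i)) * W $$ (k,i))"
      using W i by (auto simp: scalar_prod_def lessThan_atLeast0 intro!: sum.cong)
    ultimately have "r i \<noteq> 0" using gram[OF i i] by auto
    moreover have "r i \<ge> 0" unfolding r_def by (rule sum_nonneg) auto
    ultimately show ?thesis by simp
  qed
  have "mat_adjoint U * U = 1\<^sub>m n"
  proof (rule eq_matI)
    fix i j assume "i < dim_row (1\<^sub>m n :: complex mat)" "j < dim_col (1\<^sub>m n :: complex mat)"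
    then have ij: "i < n" "j < n" by auto
    have "(mat_adjoint U * U) $$ (i,j) = (\<Sum>k<n. cnj (U $$ (k,i)) * U $$ (k,j))"
      using U ij by (auto simp: scalar_prod_def lessThan_atLeast0 intro!: sum.cong)
    also have "\<dots> = (\<Sum>k<n. cnj (W $$ (k,i)) * W $$ (k,j)) * (c i * c j)"
      unfolding sum_distrib_right using ij by (intro sum.cong) (auto simp: Uind)
    also have "\<dots> = (if i = j then 1 else 0)"
    proof -
      have "r i * (c i * c i) = 1" using rpos[OF ij(1)] unfolding c_def by simp
      then show ?thesis unfolding gram[OF ij] by (auto simp flip: of_real_mult)
    qed
    finally show "(mat_adjoint U * U) $$ (i,j) = (1\<^sub>m n :: complex mat) $$ (i,j)" using ij by simp
  qed (use U in auto)
  then have "unitary_mat n U" unfolding unitary_mat_def using U by auto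
  moreover have "col U 0 = complex_of_real (c 0) \<cdot>\<^sub>v v"
    unfolding W0[symmetric] using U W n by (intro eq_vecI) (auto simp: Uind)
  ultimately show ?thesis using that by blast
qed

text \<open>Deflation: conjugating by a unitary whose first column is an eigenvector turns the first column of
  \<open>A\<close> into a multiple of the first unit vector. By symmetry the first row has the same form, so the
  matrix splits into a \<open>1 \<times> 1\<close> block and a smaller hermitian block.\<close>

theorem hermitian_spectral_form_exists:
  assumes "A \<in> carrier_mat n n" "mat_adjoint A = A"
  shows "\<exists>U d. unitary_mat n U \<and> A = spectral_form n U d"
  using assms
proof (induction n arbitrary: A)
  case 0
  have "unitary_mat 0 (1\<^sub>m 0)" unfolding unitary_mat_def by auto
  moreover have "A = spectral_form 0 (1\<^sub>m 0) (\<lambda>_. 0)"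
    using 0 spectral_form_carrier[OF calculation, of "\<lambda>_. 0"] by (intro eq_matI) auto
  ultimately show ?case by blast
next
  case (Suc n)
  note A = Suc.prems(1) and herm = Suc.prems(2)
  obtain es where es: "char_poly A = (\<Prod>a\<leftarrow>es. [:- a, 1:])" "length es = Suc n"
    using char_poly_factorized[OF A] by blast
  have "poly (char_poly A) (hd es) = 0" using es by (cases es) auto
  then have "eigenvalue A (hd es)" using eigenvalue_root_char_poly[OF A] by simp
  then obtain v e where "eigenvector A v e" unfolding eigenvalue_def by blast
  then have v: "v \<in> carrier_vec (Suc n)" "v \<noteq> 0\<^sub>v (Suc n)" and ev: "A *\<^sub>v v = e \<cdot>\<^sub>v v"
    using A unfolding eigenvector_def by auto
  obtain U c where U: "unitary_mat (Suc n) U" and U0: "col U 0 = c \<cdot>\<^sub>v v"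
    using unitary_extension[OF v] by blast
  note u = unitary_matD[OF U]
  note assoc = mat_assoc_square[where n="Suc n"]
    mult_carrier_mat[where n="Suc n"]
  define A' where "A' = mat_adjoint U * (A * U)"
  have A': "A' \<in> carrier_mat (Suc n) (Suc n)" unfolding A'_def using u A by auto
  have herm': "mat_adjoint A' = A'"
    unfolding A'_def using u(1,2) A herm
    by (simp add: mat_adjoint_mult[where n="Suc n" and m="Suc n" and k="Suc n"] assoc)
  have AUcol: "col (A * U) 0 = e \<cdot>\<^sub>v col U 0"
  proof -
    have "col (A * U) 0 = A *\<^sub>v (c \<cdot>\<^sub>v v)" using A u(1) U0 col_mult2[OF A u(1), of 0] by simp
    also have "\<dots> = c \<cdot>\<^sub>v (A *\<^sub>v v)" using A v(1) by (simp add: mult_mat_vec)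
    also have "\<dots> = e \<cdot>\<^sub>v (c \<cdot>\<^sub>v v)" unfolding ev using v by (simp add: smult_smult_assoc mult.commute)
    finally show ?thesis using U0 by simp
  qed
  have A'col: "A' $$ (i,0) = (if i = 0 then e else 0)" if i: "i < Suc n" for i
  proof -
    have "A' $$ (i,0) = row (mat_adjoint U) i \<bullet> col (A * U) 0"
      unfolding A'_def using i u A by simp
    also have "\<dots> = e * (row (mat_adjoint U) i \<bullet> col U 0)"
      unfolding AUcol using u i by (intro scalar_prod_smult_right) auto
    also have "row (mat_adjoint U) i \<bullet> col U 0 = (mat_adjoint U * U) $$ (i,0)"
      using i u(1) by simp
    finally show ?thesis unfolding u(3) using i by simp
  qed
  have A'sym: "A' $$ (i,j) = cnj (A' $$ (j,i))" if "i < Suc n" "j < Suc n" for i j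
    using that A' mat_adjoint_index[of i A' j] unfolding herm' by auto
  \<comment> \<open>The eigenvalue is a diagonal entry of a hermitian matrix, hence real.\<close>
  have e: "e = complex_of_real (Re e)"
    using A'sym[of 0 0] A'col[of 0] by (simp add: complex_eq_iff)
  define A3 where "A3 = mat n n (\<lambda>(i,j). A' $$ (Suc i, Suc j))"
  have A3: "A3 \<in> carrier_mat n n" unfolding A3_def by simp
  have "mat_adjoint A3 = A3"
    unfolding A3_def by (intro eq_matI) (auto intro!: A'sym[symmetric])
  from Suc.IH[OF A3 this] obtain V d where V: "unitary_mat n V" and A3V: "A3 = spectral_form n V d"
    by blast
  note w = unitary_matD[OF V]
  define V' where "V' = mat (Suc n) (Suc n)
    (\<lambda>(i,j). if i = 0 \<or> j = 0 then (if i = j then 1 else 0) else V $$ (i - 1, j - 1))"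
  \<comment> \<open>\<open>V'\<close> is the block diagonal matrix of \<open>1\<close> and \<open>V\<close>.\<close>
  define d' where "d' i = (case i of 0 \<Rightarrow> Re e | Suc j \<Rightarrow> d j)" for i
  have V'c: "V' \<in> carrier_mat (Suc n) (Suc n)" unfolding V'_def by simp
  have "mat_adjoint V' * V' = 1\<^sub>m (Suc n)"
  proof (rule eq_matI)
    fix i j assume "i < dim_row (1\<^sub>m (Suc n) :: complex mat)" "j < dim_col (1\<^sub>m (Suc n) :: complex mat)"
    then have ij: "i < Suc n" "j < Suc n" by auto
    have *: "(\<Sum>k<n. cnj (V $$ (k,i)) * V $$ (k,j)) = (if i = j then 1 else 0)" if "i < n" "j < n" for i j
    proof -
      have "(\<Sum>k<n. cnj (V $$ (k,i)) * V $$ (k,j)) = (mat_adjoint V * V) $$ (i,j)"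
        using w(1) that by (auto simp: scalar_prod_def lessThan_atLeast0 intro!: sum.cong)
      then show ?thesis unfolding w(3) using that by simp
    qed
    have "(mat_adjoint V' * V') $$ (i,j) = (\<Sum>k<Suc n. cnj (V' $$ (k,i)) * V' $$ (k,j))"
      using V'c ij by (auto simp: scalar_prod_def lessThan_atLeast0 intro!: sum.cong)
    also have "\<dots> = (if i = j then 1 else 0)"
      unfolding sum.lessThan_Suc_shift
      using ij *[of "i - 1" "j - 1"] by (cases i; cases j) (auto simp: V'_def)
    finally show "(mat_adjoint V' * V') $$ (i,j) = (1\<^sub>m (Suc n) :: complex mat) $$ (i,j)" using ij by simp
  qed (use V'c in auto)
  then have V': "unitary_mat (Suc n) V'" unfolding unitary_mat_def using V'c by auto
  have "A' = spectral_form (Suc n) V' d'"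
  proof (rule eq_matI)
    fix i j assume "i < dim_row (spectral_form (Suc n) V' d')" "j < dim_col (spectral_form (Suc n) V' d')"
    then have ij: "i < Suc n" "j < Suc n" using spectral_form_carrier[OF V', of d'] by auto
    have A3': "A' $$ (Suc i, Suc j) = (\<Sum>k<n. V $$ (i,k) * complex_of_real (d k) * cnj (V $$ (j,k)))"
      if "i < n" "j < n" for i j
      using that spectral_form_index[OF V that, of d] unfolding A3V[symmetric] A3_def by simp
    have row0: "A' $$ (0, Suc j) = 0" if "j < n" for j
      using A'sym[of 0 "Suc j"] A'col[of "Suc j"] that by simp
    show "A' $$ (i,j) = spectral_form (Suc n) V' d' $$ (i,j)"
      unfolding spectral_form_index[OF V' ij] sum.lessThan_Suc_shift
      using ij e A'col[of i] row0 A3'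
      by (cases i; cases j) (auto simp: V'_def d'_def)
  qed (use A' spectral_form_carrier[OF V', of d'] in auto)
  moreover have "A = U * A' * mat_adjoint U"
  proof -
    have "U * A' * mat_adjoint U = (U * mat_adjoint U) * (A * (U * mat_adjoint U))"
      unfolding A'_def using u(1,2) A by (simp add: assoc)
    then show ?thesis using u(4) A by simp
  qed
  ultimately have "A = spectral_form (Suc n) (U * V') d'"
    using spectral_form_conjugate[OF U V'] by simp
  then show ?case using unitary_mat_mult[OF U V'] by blast
qed

lemma spectral_form_permute:
  assumes U: "unitary_mat n U" and p: "p permutes {..<n}"
  obtains V where "unitary_mat n V" "spectral_form n V (\<lambda>i. d (p i)) = spectral_form n U d"
proof -
  note u = unitary_matD[OF U]
  have pn: "p i < n" if "i < n" for i using permutes_in_image[OF p, of i] that by simp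
  define V where "V = mat n n (\<lambda>(i,j). U $$ (i, p j))"
  have V: "V \<in> carrier_mat n n" unfolding V_def by simp
  have "mat_adjoint V * V = 1\<^sub>m n"
  proof (rule eq_matI)
    fix i j assume "i < dim_row (1\<^sub>m n :: complex mat)" "j < dim_col (1\<^sub>m n :: complex mat)"
    then have ij: "i < n" "j < n" by auto
    have "(mat_adjoint V * V) $$ (i,j) = (mat_adjoint U * U) $$ (p i, p j)"
      using V u(1) ij pn by (auto simp: scalar_prod_def V_def intro!: sum.cong)
    then show "(mat_adjoint V * V) $$ (i,j) = (1\<^sub>m n :: complex mat) $$ (i,j)"
      unfolding u(3) using ij pn permutes_inj[OF p] by (auto dest: injD)
  qed (use V in auto)
  then have Vu: "unitary_mat n V" unfolding unitary_mat_def using V by auto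
  moreover have "spectral_form n V (\<lambda>i. d (p i)) = spectral_form n U d"
  proof (rule eq_matI)
    fix i j assume "i < dim_row (spectral_form n U d)" "j < dim_col (spectral_form n U d)"
    then have ij: "i < n" "j < n" using spectral_form_carrier[OF U, of d] by auto
    have "spectral_form n V (\<lambda>i. d (p i)) $$ (i,j) =
      (\<Sum>k<n. (\<lambda>k. U $$ (i,k) * complex_of_real (d k) * cnj (U $$ (j,k))) (p k))"
      unfolding spectral_form_index[OF Vu ij] using ij by (intro sum.cong) (auto simp: V_def)
    also have "\<dots> = (\<Sum>k<n. U $$ (i,k) * complex_of_real (d k) * cnj (U $$ (j,k)))"
      by (rule sum.permute[OF p, symmetric, unfolded o_def])
    finally show "spectral_form n V (\<lambda>i. d (p i)) $$ (i,j) = spectral_form n U d $$ (i,j)"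
      unfolding spectral_form_index[OF U ij] .
  qed (use spectral_form_carrier[OF U, of d] spectral_form_carrier[OF Vu, of "\<lambda>i. d (p i)"] in auto)
  ultimately show ?thesis using that by blast
qed

text \<open>The reindexing \<open>p\<close> is returned so that properties of the values of \<open>d\<close>, such as nonnegativity, carry
  over to the sorted eigenvalues.\<close>

lemma spectral_form_sorted:
  assumes U: "unitary_mat n U"
  obtains V p where "unitary_mat n V" "spectral_form n V (\<lambda>i. d (p i)) = spectral_form n U d"
    "p permutes {..<n}" "\<And>i j. i \<le> j \<Longrightarrow> j < n \<Longrightarrow> d (p j) \<le> (d (p i) :: real)"
proof -
  let ?xs = "map d [0..<n]"
  let ?ys = "rev (sort ?xs)"
  have "mset ?ys = mset ?xs" by simp
  then obtain p where p: "p permutes {..<length ?xs}" "permute_list p ?xs = ?ys"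
    by (rule mset_eq_permutation)
  have pn: "p permutes {..<n}" using p(1) by simp
  have plt: "p i < n" if "i < n" for i using permutes_in_image[OF pn, of i] that by simp
  have nth: "?ys ! i = d (p i)" if "i < n" for i
    using permute_list_nth[OF p(1), of i] p(2) that plt[OF that] by simp
  have "d (p j) \<le> d (p i)" if "i \<le> j" "j < n" for i j
  proof -
    have "sorted_wrt (\<ge>) ?ys" by (simp add: sorted_wrt_rev)
    then have "?ys ! i \<ge> ?ys ! j" using that
      by (cases "i = j") (auto simp: sorted_wrt_iff_nth_less simp del: rev_nth)
    then show ?thesis using nth that by auto
  qed
  moreover obtain V where "unitary_mat n V" "spectral_form n V (\<lambda>i. d (p i)) = spectral_form n U d"
    using spectral_form_permute[OF U pn] by blast
  ultimately show ?thesis using that pn by blast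
qed

section \<open>Singular values from a spectral form\<close>

lemma char_poly_spectral_form:
  assumes "unitary_mat n U"
  shows "char_poly (spectral_form n U d) = (\<Prod>i\<leftarrow>[0..<n]. [:- complex_of_real (d i), 1:])"
proof -
  note u = unitary_matD[OF assms]
  let ?D = "mat_diag n (\<lambda>i. complex_of_real (d i))"
  have D: "?D \<in> carrier_mat n n" by simp
  have "similar_mat_wit (spectral_form n U d) ?D U (mat_adjoint U)"
    using u spectral_form_carrier[OF assms] by (intro similar_mat_witI[of _ _ n]) (auto simp: spectral_form_def)
  then have "char_poly (spectral_form n U d) = char_poly ?D"
    by (intro char_poly_similar) (auto simp: similar_mat_def)
  also have "\<dots> = (\<Prod>a\<leftarrow>diag_mat ?D. [:- a, 1:])"
    by (rule char_poly_upper_triangular[OF D]) (auto simp: mat_diag_def)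
  also have "diag_mat ?D = map (\<lambda>i. complex_of_real (d i)) [0..<n]"
    by (auto simp: diag_mat_def mat_diag_def)
  finally show ?thesis by (simp add: o_def)
qed

text \<open>The definition of singular values passes through a matrix square root, a characteristic polynomial
  and a sorting step. Any decreasing diagonalization of \<open>X\<^sup>* X\<close> bypasses them: the square root has the
  diagonal \<open>s\<close>, and sorting leaves a decreasing list unchanged up to reversal.\<close>

lemma singular_values_eqI:
  assumes U: "unitary_mat n U" and X: "mat_adjoint X * X = spectral_form n U (\<lambda>i. (s i)\<^sup>2)"
    and nonneg: "\<And>i. i < n \<Longrightarrow> 0 \<le> s i" and mono: "\<And>i j. i \<le> j \<Longrightarrow> j < n \<Longrightarrow> s j \<le> s i"
  shows "singular_values X = map s [0..<n]"
proof -
  have sq: "((s i)\<^sup>2) powr (1/2) = s i" if "i < n" for i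
    using nonneg[OF that] by (simp add: powr_half_sqrt)
  have "char_poly (mat_powr (mat_adjoint X * X) (1/2)) = (\<Prod>i\<leftarrow>[0..<n]. [:- complex_of_real (s i), 1:])"
    unfolding X mat_powr_spectral_form[OF U] char_poly_spectral_form[OF U]
    using sq by (intro arg_cong[of _ _ prod_list] map_cong) auto
  moreover have "proots (\<Prod>i\<leftarrow>xs. [:- complex_of_real (s i), 1:]) = mset (map (\<lambda>i. complex_of_real (s i)) xs)" for xs
  proof (induction xs)
    case (Cons x xs)
    have "(\<Prod>i\<leftarrow>xs. [:- complex_of_real (s i), 1:]) \<noteq> 0" by (auto simp: prod_list_zero_iff)
    then have "proots ([:- complex_of_real (s x), 1:] * (\<Prod>i\<leftarrow>xs. [:- complex_of_real (s i), 1:]))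
      = proots [:- complex_of_real (s x), 1:] + proots (\<Prod>i\<leftarrow>xs. [:- complex_of_real (s i), 1:])"
      by (intro proots_mult) auto
    then show ?case using Cons.IH by simp
  qed simp
  ultimately have "image_mset Re (proots (char_poly (mat_powr (mat_adjoint X * X) (1/2)))) = mset (map s [0..<n])"
    by (simp add: multiset.map_comp o_def)
  moreover have "sort (map s [0..<n]) = rev (map s [0..<n])"
  proof (rule properties_for_sort)
    have "sorted_wrt (\<ge>) (map s [0..<n])"
      using mono by (auto simp: sorted_wrt_iff_nth_less)
    then show "sorted (rev (map s [0..<n]))" by (simp add: sorted_wrt_rev)
  qed simp
  ultimately show ?thesis
    unfolding singular_values_def by (simp del: mset_map)
qed

text \<open>The eigenvalues of \<open>X\<^sup>* X\<close> are the squared column norms of \<open>X U\<close>, hence nonnegative.\<close>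

lemma singular_values_spectral:
  assumes X: "X \<in> carrier_mat n n"
  obtains U s where "unitary_mat n U" "mat_adjoint X * X = spectral_form n U (\<lambda>i. (s i)\<^sup>2)"
    "\<And>i. 0 \<le> s i" "\<And>i j. i \<le> j \<Longrightarrow> j < n \<Longrightarrow> s j \<le> (s i :: real)"
    "singular_values X = map s [0..<n]"
proof -
  have X': "mat_adjoint X \<in> carrier_mat n n" using X by (rule mat_adjoint_carrier)
  have "mat_adjoint (mat_adjoint X * X) = mat_adjoint X * X"
    using mat_adjoint_mult[OF X' X] by simp
  then obtain U0 d where U0: "unitary_mat n U0" and d: "mat_adjoint X * X = spectral_form n U0 d"
    using hermitian_spectral_form_exists[of "mat_adjoint X * X" n] X X' by auto
  note u0 = unitary_matD[OF U0]
  have dnn: "d i \<ge> 0" if i: "i < n" for i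
  proof -
    have XU: "X * U0 \<in> carrier_mat n n" using X u0 by simp
    have "mat_adjoint (X * U0) * (X * U0) = mat_adjoint U0 * (mat_adjoint X * X) * U0"
      using X X' u0(1,2) by (simp add: mat_adjoint_mult[OF X u0(1)] mat_assoc_square[where n=n] mult_carrier_mat[where n=n])
    also have "\<dots> = (mat_adjoint U0 * U0) * mat_diag n (\<lambda>i. complex_of_real (d i)) * (mat_adjoint U0 * U0)"
      unfolding d spectral_form_def
      using u0(1,2) by (simp add: mat_assoc_square[where n=n] mult_carrier_mat[where n=n])
    also have "\<dots> = mat_diag n (\<lambda>i. complex_of_real (d i))" unfolding u0(3)
      by (simp add: left_mult_one_mat[where nr=n and nc=n] right_mult_one_mat[where nr=n and nc=n])
    finally have "complex_of_real (d i) = (mat_adjoint (X * U0) * (X * U0)) $$ (i,i)"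
      using i by (simp add: mat_diag_def)
    also have "\<dots> = (\<Sum>k<n. complex_of_real ((cmod ((X * U0) $$ (k,i)))\<^sup>2))"
    proof -
      have "(mat_adjoint Y * Y) $$ (i,i) = (\<Sum>k<n. complex_of_real ((cmod (Y $$ (k,i)))\<^sup>2))"
        if "Y \<in> carrier_mat n n" for Y :: "complex mat"
        unfolding complex_norm_square using that i
        by (auto simp: scalar_prod_def lessThan_atLeast0 mult.commute intro!: sum.cong)
      then show ?thesis using XU by blast
    qed
    finally have "d i = (\<Sum>k<n. (cmod ((X * U0) $$ (k,i)))\<^sup>2)"
      unfolding of_real_sum[symmetric] of_real_eq_iff .
    then show ?thesis by (simp add: sum_nonneg)
  qed
  obtain U p where U: "unitary_mat n U" and Up: "spectral_form n U (\<lambda>i. d (p i)) = spectral_form n U0 d"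
    and p: "p permutes {..<n}" and mono: "\<And>i j. i \<le> j \<Longrightarrow> j < n \<Longrightarrow> d (p j) \<le> d (p i)"
    using spectral_form_sorted[OF U0, of d] by metis
  define s where "s i = (if i < n then sqrt (d (p i)) else 0)" for i
  have pn: "p i < n" if "i < n" for i using permutes_in_image[OF p, of i] that by simp
  have s2: "(s i)\<^sup>2 = d (p i)" if "i < n" for i using dnn[OF pn[OF that]] that unfolding s_def by simp
  have eq: "mat_adjoint X * X = spectral_form n U (\<lambda>i. (s i)\<^sup>2)"
    unfolding d Up[symmetric]
    using spectral_form_carrier[OF U] s2
    by (intro eq_matI) (auto simp: spectral_form_index[OF U] carrier_matD[OF spectral_form_carrier[OF U]])
  have snn: "0 \<le> s i" for i using dnn[OF pn] unfolding s_def by auto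
  have sm: "s j \<le> s i" if "i \<le> j" "j < n" for i j using mono[OF that] that unfolding s_def by auto
  show ?thesis using that[OF U eq snn sm singular_values_eqI[OF U eq snn sm]] by blast
qed

lemma length_singular_values: "X \<in> carrier_mat n n \<Longrightarrow> length (singular_values X) = n"
  by (erule singular_values_spectral) simp

section \<open>Gram determinants and Horn's inequality\<close>

text \<open>The \<open>i\<close>-th smallest element of a set of naturals is at least \<open>i\<close>, so listing the image of \<open>f\<close> in
  increasing order compares the two products factor by factor.\<close>

lemma prod_reindexed_le_prod_initial:
  fixes d :: "nat \<Rightarrow> real"
  assumes inj: "inj_on f {0..<k}" and fn: "\<And>i. i < k \<Longrightarrow> f i < n"
    and nonneg: "\<And>i. i < n \<Longrightarrow> 0 \<le> d i" and mono: "\<And>i j. i \<le> j \<Longrightarrow> j < n \<Longrightarrow> d j \<le> d i"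
  shows "(\<Prod>i<k. d (f i)) \<le> (\<Prod>i<k. d i)"
proof -
  define S where "S = f ` {0..<k}"
  define xs where "xs = sorted_list_of_set S"
  have S: "finite S" "card S = k" "S \<subseteq> {..<n}"
    unfolding S_def using inj fn by (auto simp: card_image)
  have xs: "sorted_wrt (<) xs" "length xs = k" "set xs = S" "distinct xs"
    unfolding xs_def using S by auto
  have "(\<Prod>i<k. d (f i)) = prod d S"
    unfolding S_def prod.reindex[OF inj] by (simp add: lessThan_atLeast0)
  also have "\<dots> = prod_list (map d xs)"
    using xs by (metis prod.distinct_set_conv_list)
  also have "\<dots> = (\<Prod>i<k. d (xs ! i))"
    using xs(2) by (simp add: prod.list_conv_set_nth lessThan_atLeast0)
  also have "\<dots> \<le> (\<Prod>i<k. d i)"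
  proof (rule prod_mono)
    fix i assume "i \<in> {..<k}"
    then have "i \<le> xs ! i" "xs ! i < n"
      using sorted_wrt_less_idx[OF xs(1)] xs S(3) nth_mem[of i xs] by auto
    then show "0 \<le> d (xs ! i) \<and> d (xs ! i) \<le> d i" using nonneg mono by auto
  qed
  finally show ?thesis .
qed

text \<open>A Cauchy--Binet formula, with the sum over all index functions \<open>f\<close> rather than over \<open>k\<close>-subsets; this
  counts every subset \<open>k!\<close> times. Expanding the determinant by rows gives a sum over \<open>f\<close> that is not
  symmetric in the two factors. Replacing \<open>f\<close> by \<open>f \<circ> p\<close> does not change that sum, and averaging over
  all permutations \<open>p\<close> assembles the second determinant. The index functions are the identity
  outside \<open>{0..<k}\<close> so that they form a finite set closed under composition with \<open>p\<close>.\<close>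

lemma det_weighted_gram:
  fixes W :: "complex mat" and d :: "nat \<Rightarrow> real"
  assumes W: "W \<in> carrier_mat n k"
  shows "det (mat_adjoint W * mat_diag n (\<lambda>i. complex_of_real (d i)) * W) =
    complex_of_real ((\<Sum>f | (\<forall>i\<in>{0..<k}. f i \<in> {0..<n}) \<and> (\<forall>i. i \<notin> {0..<k} \<longrightarrow> f i = i).
      (\<Prod>i<k. d (f i)) * (cmod (det (mat k k (\<lambda>(i,j). W $$ (f i, j)))))\<^sup>2) / fact k)"
proof -
  define F where "F = {f. (\<forall>i\<in>{0..<k}. f i \<in> {0..<n}) \<and> (\<forall>i. i \<notin> {0..<k} \<longrightarrow> f i = i)}"
  define P where "P = {p. p permutes {0..<k}}"
  define M where "M f = mat k k (\<lambda>(i,j). W $$ (f i, j))" for f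
  have M: "M f \<in> carrier_mat k k" for f unfolding M_def by simp
  define A where "A = mat_adjoint W * mat_diag n (\<lambda>i. complex_of_real (d i))"
  have W': "mat_adjoint W \<in> carrier_mat k n" using W by (rule mat_adjoint_carrier_rect)
  have A: "A \<in> carrier_mat k n" unfolding A_def using W' by auto
  have Aind: "A $$ (i,j) = cnj (W $$ (j,i)) * of_real (d j)" if "i < k" "j < n" for i j
    unfolding A_def mat_diag_mult_right[OF W'] using that W by simp
  have finF: "finite F" unfolding F_def by (rule finite_bounded_functions) auto
  have finP: "finite P" unfolding P_def by (rule finite_permutations) simp
  have cardP: "card P = fact k" unfolding P_def using card_permutations[of "{0..<k}" k] by simp
  define g where "g f = (\<Prod>i<k. complex_of_real (d (f i))) * (\<Prod>i<k. cnj (W $$ (f i, i))) * det (M f)" for f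
  have det1: "det (A * W) = (\<Sum>f\<in>F. g f)"
  proof -
    have "det (A * W) = det (mat\<^sub>r k k (\<lambda>i. finsum_vec TYPE(complex) k (\<lambda>j. A $$ (i,j) \<cdot>\<^sub>v row W j) {0..<n}))"
      unfolding mat_mul_finsum_alt[OF A W] ..
    also have "\<dots> = (\<Sum>f\<in>F. det (mat\<^sub>r k k (\<lambda>i. A $$ (i, f i) \<cdot>\<^sub>v row W (f i))))"
      unfolding F_def by (rule det_linear_rows_sum) (use W in auto)
    also have "\<dots> = (\<Sum>f\<in>F. g f)"
    proof (rule sum.cong[OF refl])
      fix f assume f: "f \<in> F"
      have "det (mat\<^sub>r k k (\<lambda>i. A $$ (i, f i) \<cdot>\<^sub>v row W (f i))) =
        (\<Prod>i\<in>{0..<k}. A $$ (i, f i)) * det (mat\<^sub>r k k (\<lambda>i. row W (f i)))"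
        by (rule det_rows_mul) (use W in auto)
      also have "mat\<^sub>r k k (\<lambda>i. row W (f i)) = M f"
        unfolding M_def using W f by (intro eq_matI) (auto simp: F_def)
      also have "(\<Prod>i\<in>{0..<k}. A $$ (i, f i)) = (\<Prod>i<k. cnj (W $$ (f i, i)) * of_real (d (f i)))"
        unfolding lessThan_atLeast0 using f by (intro prod.cong) (auto simp: Aind F_def)
      finally show "det (mat\<^sub>r k k (\<lambda>i. A $$ (i, f i) \<cdot>\<^sub>v row W (f i))) = g f"
        unfolding g_def prod.distrib by (simp add: mult.commute)
    qed
    finally show ?thesis .
  qed
  have reindex: "(\<Sum>f\<in>F. g f) = (\<Sum>f\<in>F. g (f \<circ> p))" if "p \<in> P" for p
  proof -
    have p: "p permutes {0..<k}" using that unfolding P_def by simp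
    let ?q = "Hilbert_Choice.inv p"
    have q: "?q permutes {0..<k}" using p by (rule permutes_inv)
    have comp: "f \<circ> r \<in> F" if "f \<in> F" "r permutes {0..<k}" for f r
      using that permutes_in_image[OF that(2)] permutes_not_in[OF that(2)] unfolding F_def by auto
    show ?thesis
      by (rule sum.reindex_bij_witness[of _ "\<lambda>f. f \<circ> p" "\<lambda>f. f \<circ> ?q"])
        (auto simp: comp p q o_assoc[symmetric] permutes_inv_o[OF p])
  qed
  \<comment> \<open>Permuting the rows produces a sign, and the signed products add up to the conjugate determinant.\<close>
  have gperm: "(\<Sum>p\<in>P. g (f \<circ> p)) = (\<Prod>i<k. complex_of_real (d (f i))) * of_real ((cmod (det (M f)))\<^sup>2)"
    for f
  proof -
    have "g (f \<circ> p) = (\<Prod>i<k. complex_of_real (d (f i))) * det (M f) *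
        (signof p * (\<Prod>i<k. cnj (M f $$ (p i, i))))" if "p \<in> P" for p
    proof -
      have p: "p permutes {0..<k}" using that unfolding P_def by simp
      have pk: "p i < k" if "i < k" for i using permutes_in_image[OF p, of i] that by simp
      have "M (f \<circ> p) = mat k k (\<lambda>(i,j). M f $$ (p i, j))"
        using pk unfolding M_def by (intro eq_matI) auto
      then have "det (M (f \<circ> p)) = signof p * det (M f)" using det_permute_rows[OF M p] by simp
      moreover have "(\<Prod>i<k. complex_of_real (d (f (p i)))) = (\<Prod>i<k. complex_of_real (d (f i)))"
        using prod.permute[OF p, of "\<lambda>i. complex_of_real (d (f i))"] by (simp add: o_def lessThan_atLeast0)
      moreover have "(\<Prod>i<k. cnj (W $$ (f (p i), i))) = (\<Prod>i<k. cnj (M f $$ (p i, i)))"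
        using pk unfolding M_def by (intro prod.cong) auto
      ultimately show ?thesis unfolding g_def by (simp add: mult_ac)
    qed
    then have "(\<Sum>p\<in>P. g (f \<circ> p)) = (\<Prod>i<k. complex_of_real (d (f i))) * det (M f) *
        (\<Sum>p\<in>P. signof p * (\<Prod>i<k. cnj (M f $$ (p i, i))))"
      by (simp add: sum_distrib_left)
    also have "(\<Sum>p\<in>P. signof p * (\<Prod>i<k. cnj (M f $$ (p i, i)))) = cnj (det (M f))"
      unfolding det_col[OF M] P_def by (simp add: cnj_sum cnj_prod)
    finally show ?thesis by (simp only: mult.assoc complex_norm_square[symmetric])
  qed
  have "fact k * det (A * W) = (\<Sum>p\<in>P. \<Sum>f\<in>F. g (f \<circ> p))"
  proof -
    have "(\<Sum>p\<in>P. \<Sum>f\<in>F. g (f \<circ> p)) = (\<Sum>p\<in>P. \<Sum>f\<in>F. g f)"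
      by (rule sum.cong[OF refl]) (rule reindex[symmetric])
    then show ?thesis by (simp add: det1 cardP)
  qed
  also have "\<dots> = (\<Sum>f\<in>F. \<Sum>p\<in>P. g (f \<circ> p))" by (rule sum.swap)
  also have "\<dots> = complex_of_real (\<Sum>f\<in>F. (\<Prod>i<k. d (f i)) * (cmod (det (M f)))\<^sup>2)"
    unfolding gperm by simp
  finally have "det (A * W) = complex_of_real (\<Sum>f\<in>F. (\<Prod>i<k. d (f i)) * (cmod (det (M f)))\<^sup>2) / fact k"
    by (simp add: field_simps)
  then show ?thesis unfolding A_def F_def M_def by simp
qed

text \<open>In the eigenbasis every term of the Cauchy--Binet sum for the left side is the corresponding term for
  \<open>det (V\<^sup>* V)\<close> times a product of \<open>k\<close> eigenvalues. For injective \<open>f\<close> that product is at most the product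
  of the top \<open>k\<close>; for the others the minor has two equal rows and vanishes.\<close>

lemma det_compression_le:
  assumes U: "unitary_mat n U" and V: "V \<in> carrier_mat n k"
    and nonneg: "\<And>i. i < n \<Longrightarrow> 0 \<le> d i" and mono: "\<And>i j. i \<le> j \<Longrightarrow> j < n \<Longrightarrow> d j \<le> d i"
  shows "Re (det (mat_adjoint V * spectral_form n U d * V)) \<le> (\<Prod>i<k. d i) * Re (det (mat_adjoint V * V))"
proof -
  note u = unitary_matD[OF U]
  define W where "W = mat_adjoint U * V"
  have W: "W \<in> carrier_mat n k" unfolding W_def using u V by simp
  have V': "mat_adjoint V \<in> carrier_mat k n" using V by (rule mat_adjoint_carrier_rect)
  have W': "mat_adjoint W = mat_adjoint V * U" unfolding W_def using mat_adjoint_mult[OF u(2) V] by simp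
  have conj: "mat_adjoint V * (U * D * mat_adjoint U) * V = mat_adjoint W * D * W"
    if D: "D \<in> carrier_mat n n" for D
  proof -
    have "mat_adjoint V * (U * D * mat_adjoint U) * V = mat_adjoint V * ((U * D) * (mat_adjoint U * V))"
      using V V' u(1,2) D
      by (simp add: assoc_mult_mat[of _ k n _ n _ k] assoc_mult_mat[of _ n n _ n _ k])
    also have "\<dots> = mat_adjoint V * (U * (D * W))"
      unfolding W_def[symmetric] using u(1) D W by (simp add: assoc_mult_mat[of _ n n _ n _ k])
    also have "\<dots> = mat_adjoint W * D * W"
      unfolding W' using u(1) D W V' by (simp add: assoc_mult_mat[of _ k n _ n _ k] assoc_mult_mat[of _ k n _ n _ n])
    finally show ?thesis .
  qed
  define F where "F = {f. (\<forall>i\<in>{0..<k}. f i \<in> {0..<n}) \<and> (\<forall>i. i \<notin> {0..<k} \<longrightarrow> f i = i)}"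
  define m where "m f = (cmod (det (mat k k (\<lambda>(i,j). W $$ (f i, j)))))\<^sup>2" for f
  have formula: "Re (det (mat_adjoint V * spectral_form n U e * V)) = (\<Sum>f\<in>F. (\<Prod>i<k. e (f i)) * m f) / fact k" for e
    unfolding spectral_form_def conj[OF mat_diag_dim] det_weighted_gram[OF W] F_def m_def
    by (rule Re_complex_of_real)
  have "spectral_form n U (\<lambda>_. 1) = 1\<^sub>m n" unfolding spectral_form_def using u by simp
  then have one: "Re (det (mat_adjoint V * V)) = (\<Sum>f\<in>F. m f) / fact k"
    using formula[of "\<lambda>_. 1"] right_mult_one_mat[OF V'] by simp
  have "(\<Sum>f\<in>F. (\<Prod>i<k. d (f i)) * m f) \<le> (\<Sum>f\<in>F. (\<Prod>i<k. d i) * m f)"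
  proof (rule sum_mono)
    fix f assume f: "f \<in> F"
    show "(\<Prod>i<k. d (f i)) * m f \<le> (\<Prod>i<k. d i) * m f"
    proof (cases "inj_on f {0..<k}")
      case True
      then show ?thesis using f unfolding F_def m_def
        by (intro mult_right_mono prod_reindexed_le_prod_initial[OF True _ nonneg mono]) auto
    next
      case False
      then obtain i j where ij: "i \<noteq> j" "i < k" "j < k" "f i = f j" unfolding inj_on_def by auto
      have "det (mat k k (\<lambda>(i,j). W $$ (f i, j))) = 0"
        by (rule det_identical_rows[of _ k i j]) (use ij in auto)
      then show ?thesis unfolding m_def by simp
    qed
  qed
  then show ?thesis
    unfolding formula one by (simp add: sum_distrib_left divide_right_mono)
qed

text \<open>The witness \<open>V\<close> consists of the first \<open>k\<close> columns of \<open>U\<close>.\<close>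

lemma det_compression_attained:
  assumes U: "unitary_mat n U" and k: "k \<le> n"
  obtains V where "V \<in> carrier_mat n k" "mat_adjoint V * V = 1\<^sub>m k"
    "Re (det (mat_adjoint V * spectral_form n U d * V)) = (\<Prod>i<k. d i)"
proof -
  note u = unitary_matD[OF U]
  define E :: "complex mat" where "E = mat n k (\<lambda>(i,j). if i = j then 1 else 0)"
  define V where "V = U * E"
  have E: "E \<in> carrier_mat n k" "mat_adjoint E \<in> carrier_mat k n" unfolding E_def by (auto intro!: carrier_matI)
  have V: "V \<in> carrier_mat n k" unfolding V_def using u E by simp
  have V': "mat_adjoint V = mat_adjoint E * mat_adjoint U" unfolding V_def by (rule mat_adjoint_mult[OF u(1) E(1)])
  have EDE: "mat_adjoint E * (mat_diag n e * E) = mat_diag k e" for e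
    unfolding mat_diag_mult_left[OF E(1)] using k
    by (intro eq_matI) (auto simp: E_def scalar_prod_def mat_diag_def if_distrib[of cnj] if_distrib[of "(*) _"] if_distribR sum.delta cong: if_cong)
  have conj: "mat_adjoint V * (U * D * mat_adjoint U) * V = mat_adjoint E * (D * E)"
    if D: "D \<in> carrier_mat n n" for D
  proof -
    have "mat_adjoint V * (U * D * mat_adjoint U) * V = mat_adjoint E * ((mat_adjoint U * U) * D * (mat_adjoint U * U) * E)"
      unfolding V' unfolding V_def using E u(1,2) D
      by (simp add: assoc_mult_mat[of _ k n _ n _ k] assoc_mult_mat[of _ k n _ n _ n] assoc_mult_mat[of _ n n _ n _ k] mat_assoc_square[where n=n] mult_carrier_mat[where n=n])
    then show ?thesis unfolding u(3) using D by simp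
  qed
  have "mat_adjoint V * V = 1\<^sub>m k"
  proof -
    have "mat_adjoint V * V = mat_adjoint E * ((mat_adjoint U * U) * E)"
      unfolding V' unfolding V_def using E u(1,2)
      by (simp add: assoc_mult_mat[of _ k n _ n _ k] assoc_mult_mat[of _ n n _ n _ k])
    then show ?thesis using EDE[of "\<lambda>_. 1"] u(3) E by simp
  qed
  moreover have "Re (det (mat_adjoint V * spectral_form n U d * V)) = (\<Prod>i<k. d i)"
  proof -
    have "det (mat_diag k (\<lambda>i. complex_of_real (d i))) = (\<Prod>i<k. complex_of_real (d i))"
      by (subst det_upper_triangular[of _ k]) (auto simp: mat_diag_def diag_mat_def prod.list_conv_set_nth lessThan_atLeast0)
    then have "det (mat_adjoint V * spectral_form n U d * V) = complex_of_real (\<Prod>i<k. d i)"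
      unfolding spectral_form_def using conj EDE by simp
    then show ?thesis by (simp del: of_real_prod)
  qed
  ultimately show ?thesis using that V by blast
qed

definition top_singular_prod :: "nat \<Rightarrow> complex mat \<Rightarrow> real" where
  "top_singular_prod k X = (\<Prod>i<k. singular_values X ! i)"

lemma top_singular_prod_nonneg:
  assumes "X \<in> carrier_mat n n" "k \<le> n"
  shows "0 \<le> top_singular_prod k X"
proof -
  obtain U s where "\<And>i. 0 \<le> s i" "singular_values X = map s [0..<n]"
    using singular_values_spectral[OF assms(1)] by metis
  then show ?thesis unfolding top_singular_prod_def using assms(2) by (auto intro!: prod_nonneg)
qed

lemma det_gram_image_le:
  assumes X: "X \<in> carrier_mat n n" and V: "V \<in> carrier_mat n k" and k: "k \<le> n"
  shows "Re (det (mat_adjoint (X * V) * (X * V))) \<le> (top_singular_prod k X)\<^sup>2 * Re (det (mat_adjoint V * V))"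
proof -
  obtain U s where U: "unitary_mat n U" and XX: "mat_adjoint X * X = spectral_form n U (\<lambda>i. (s i)\<^sup>2)"
    and s: "\<And>i. 0 \<le> s i" "\<And>i j. i \<le> j \<Longrightarrow> j < n \<Longrightarrow> s j \<le> s i" "singular_values X = map s [0..<n]"
    using singular_values_spectral[OF X] by metis
  have c: "mat_adjoint X \<in> carrier_mat n n" "mat_adjoint V \<in> carrier_mat k n"
    using X V by (auto intro: mat_adjoint_carrier_rect)
  have "mat_adjoint (X * V) * (X * V) = mat_adjoint V * (mat_adjoint X * X) * V"
    unfolding mat_adjoint_mult[OF X V] using X V c
    by (simp add: assoc_mult_mat[of _ k n _ n _ k] assoc_mult_mat[of _ k n _ n _ n] assoc_mult_mat[of _ n n _ n _ k])
  moreover have "Re (det (mat_adjoint V * (mat_adjoint X * X) * V)) \<le> (\<Prod>i<k. (s i)\<^sup>2) * Re (det (mat_adjoint V * V))"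
    unfolding XX using s by (intro det_compression_le[OF U V]) (auto intro: power_mono)
  moreover have "(\<Prod>i<k. (s i)\<^sup>2) = (top_singular_prod k X)\<^sup>2"
    unfolding top_singular_prod_def s(3) prod_power_distrib using k by (intro prod.cong) auto
  ultimately show ?thesis by simp
qed

lemma det_gram_image_attained:
  assumes X: "X \<in> carrier_mat n n" and k: "k \<le> n"
  obtains V where "V \<in> carrier_mat n k" "mat_adjoint V * V = 1\<^sub>m k"
    "Re (det (mat_adjoint (X * V) * (X * V))) = (top_singular_prod k X)\<^sup>2"
proof -
  obtain U s where U: "unitary_mat n U" and XX: "mat_adjoint X * X = spectral_form n U (\<lambda>i. (s i)\<^sup>2)"
    and s: "singular_values X = map s [0..<n]"
    using singular_values_spectral[OF X] by metis
  obtain V where V: "V \<in> carrier_mat n k" "mat_adjoint V * V = 1\<^sub>m k"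
    "Re (det (mat_adjoint V * (mat_adjoint X * X) * V)) = (\<Prod>i<k. (s i)\<^sup>2)"
    using det_compression_attained[OF U k, of "\<lambda>i. (s i)\<^sup>2"] unfolding XX by metis
  have c: "mat_adjoint X \<in> carrier_mat n n" "mat_adjoint V \<in> carrier_mat k n"
    using X V by (auto intro: mat_adjoint_carrier_rect)
  have "mat_adjoint (X * V) * (X * V) = mat_adjoint V * (mat_adjoint X * X) * V"
    unfolding mat_adjoint_mult[OF X V(1)] using X V(1) c
    by (simp add: assoc_mult_mat[of _ k n _ n _ k] assoc_mult_mat[of _ k n _ n _ n] assoc_mult_mat[of _ n n _ n _ k])
  moreover have "(\<Prod>i<k. (s i)\<^sup>2) = (top_singular_prod k X)\<^sup>2"
    unfolding top_singular_prod_def s prod_power_distrib using k by (intro prod.cong) auto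
  ultimately show ?thesis using that[OF V(1,2)] V(3) by simp
qed

text \<open>Horn's inequality: choose \<open>V\<close> optimal for \<open>X Y\<close>, then apply the Gram determinant bound for \<open>X\<close> to
  \<open>Y V\<close> and the one for \<open>Y\<close> to \<open>V\<close>.\<close>

theorem top_singular_prod_mult_le:
  assumes X: "X \<in> carrier_mat n n" and Y: "Y \<in> carrier_mat n n" and k: "k \<le> n"
  shows "top_singular_prod k (X * Y) \<le> top_singular_prod k X * top_singular_prod k Y"
proof -
  have XY: "X * Y \<in> carrier_mat n n" using X Y by simp
  obtain V where V: "V \<in> carrier_mat n k" "mat_adjoint V * V = 1\<^sub>m k"
    "Re (det (mat_adjoint (X * Y * V) * (X * Y * V))) = (top_singular_prod k (X * Y))\<^sup>2"
    using det_gram_image_attained[OF XY k] by metis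
  have YV: "Y * V \<in> carrier_mat n k" using Y V by simp
  have "(top_singular_prod k (X * Y))\<^sup>2 = Re (det (mat_adjoint (X * (Y * V)) * (X * (Y * V))))"
    using V(3) assoc_mult_mat[OF X Y V(1)] by simp
  also have "\<dots> \<le> (top_singular_prod k X)\<^sup>2 * Re (det (mat_adjoint (Y * V) * (Y * V)))"
    by (rule det_gram_image_le[OF X YV k])
  also have "\<dots> \<le> (top_singular_prod k X)\<^sup>2 * ((top_singular_prod k Y)\<^sup>2 * Re (det (mat_adjoint V * V)))"
    by (intro mult_left_mono det_gram_image_le[OF Y V(1) k]) auto
  also have "\<dots> = (top_singular_prod k X * top_singular_prod k Y)\<^sup>2"
    using V(2) by (simp add: power_mult_distrib)
  finally show ?thesis
    using top_singular_prod_nonneg[OF X k] top_singular_prod_nonneg[OF Y k] by (meson power2_le_imp_le mult_nonneg_nonneg)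
qed

section \<open>Calculus of the products of top singular values\<close>

lemma mat_adjoint_spectral_form:
  assumes "unitary_mat n U"
  shows "mat_adjoint (spectral_form n U d) = spectral_form n U d"
proof -
  note u = unitary_matD[OF assms]
  let ?D = "mat_diag n (\<lambda>i. complex_of_real (d i))"
  have UD: "U * ?D \<in> carrier_mat n n" using u(1) by auto
  show ?thesis
    unfolding spectral_form_def mat_adjoint_mult[OF UD u(2)] mat_adjoint_mult[OF u(1) mat_diag_dim] mat_adjoint_real_diag
    using u(1,2) by (simp add: mat_assoc_square[where n=n])
qed

lemma spectral_form_mult:
  assumes "unitary_mat n U"
  shows "spectral_form n U d * spectral_form n U e = spectral_form n U (\<lambda>i. d i * e i)"
proof -
  note u = unitary_matD[OF assms]
  let ?D = "\<lambda>d. mat_diag n (\<lambda>i. complex_of_real (d i))"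
  have "spectral_form n U d * spectral_form n U e = U * (?D d * ((mat_adjoint U * U) * ?D e)) * mat_adjoint U"
    unfolding spectral_form_def using u(1,2)
    by (simp add: mat_assoc_square[where n=n] mult_carrier_mat[where n=n])
  also have "\<dots> = spectral_form n U (\<lambda>i. d i * e i)"
    unfolding u(3) spectral_form_def by (simp add: left_mult_one_mat[where nr=n and nc=n])
  finally show ?thesis .
qed

lemma spectral_form_one:
  assumes "unitary_mat n U"
  shows "spectral_form n U (\<lambda>_. 1) = 1\<^sub>m n"
  unfolding spectral_form_def using unitary_matD[OF assms] by simp

lemma spectral_form_pow:
  assumes "unitary_mat n U"
  shows "spectral_form n U d ^\<^sub>m m = spectral_form n U (\<lambda>i. d i ^ m)"
proof (induction m)
  case 0
  then show ?case using spectral_form_one[OF assms] carrier_matD(1)[OF spectral_form_carrier[OF assms, of d]] by simp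
next
  case (Suc m)
  then show ?case by (simp add: spectral_form_mult[OF assms] mult.commute)
qed

text \<open>An increasing \<open>f\<close> keeps the eigenvalues in order, so the top \<open>k\<close> of \<open>f(H)\<close> are the images of the top
  \<open>k\<close> of \<open>H\<close>; multiplicativity of \<open>f\<close> then moves it out of the product.\<close>

lemma top_singular_prod_functional_calculus:
  fixes d f :: "_ \<Rightarrow> real"
  assumes U: "unitary_mat n U" and d: "\<And>i. i < n \<Longrightarrow> 0 \<le> d i" and k: "k \<le> n"
    and f0: "\<And>x. 0 \<le> x \<Longrightarrow> 0 \<le> f x" and fm: "\<And>x y. 0 \<le> x \<Longrightarrow> x \<le> y \<Longrightarrow> f x \<le> f y"
    and fprod: "\<And>x. f (\<Prod>i<k. x i) = (\<Prod>i<k. f (x i))"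
  shows "top_singular_prod k (spectral_form n U (\<lambda>i. f (d i))) = f (top_singular_prod k (spectral_form n U d))"
proof -
  obtain V p where V: "unitary_mat n V" and Vp: "spectral_form n V (\<lambda>i. d (p i)) = spectral_form n U d"
    and p: "p permutes {..<n}" and mono: "\<And>i j. i \<le> j \<Longrightarrow> j < n \<Longrightarrow> d (p j) \<le> d (p i)"
    using spectral_form_sorted[OF U, of d] by metis
  have pn: "p i < n" if "i < n" for i using permutes_in_image[OF p, of i] that by simp
  have nn: "0 \<le> d (p i)" if "i < n" for i using d[OF pn[OF that]] .
  have eq: "spectral_form n U (\<lambda>i. f (d i)) = spectral_form n V (\<lambda>i. f (d (p i)))"
    using spectral_form_eqD[OF V U Vp, of f] by simp
  have "singular_values (spectral_form n V (\<lambda>i. d (p i))) = map (\<lambda>i. d (p i)) [0..<n]"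
    by (rule singular_values_eqI[OF V])
      (use mono nn in \<open>auto simp: mat_adjoint_spectral_form[OF V] spectral_form_mult[OF V] power2_eq_square\<close>)
  moreover have "singular_values (spectral_form n V (\<lambda>i. f (d (p i)))) = map (\<lambda>i. f (d (p i))) [0..<n]"
    by (rule singular_values_eqI[OF V])
      (use mono nn f0 fm in \<open>auto simp: mat_adjoint_spectral_form[OF V] spectral_form_mult[OF V] power2_eq_square\<close>)
  ultimately show ?thesis
    unfolding eq Vp[symmetric] top_singular_prod_def using k by (simp add: fprod)
qed

lemma top_singular_prod_pow:
  assumes U: "unitary_mat n U" and d: "\<And>i. i < n \<Longrightarrow> 0 \<le> d i" and k: "k \<le> n"
  shows "top_singular_prod k (spectral_form n U (\<lambda>i. d i ^ m)) = top_singular_prod k (spectral_form n U d) ^ m"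
  by (rule top_singular_prod_functional_calculus[OF U _ k])
    (auto intro: d power_mono simp: prod_power_distrib)

lemma top_singular_prod_powr:
  assumes U: "unitary_mat n U" and d: "\<And>i. i < n \<Longrightarrow> 0 \<le> d i" and k: "k \<le> n" and r: "0 \<le> r"
  shows "top_singular_prod k (spectral_form n U (\<lambda>i. d i powr r)) = top_singular_prod k (spectral_form n U d) powr r"
  by (rule top_singular_prod_functional_calculus[OF U _ k])
    (auto intro: d powr_mono2 r simp: prod_powr_distrib)

lemma top_singular_prod_one:
  assumes k: "k \<le> n"
  shows "top_singular_prod k (1\<^sub>m n) = 1"
proof -
  have U: "unitary_mat n (1\<^sub>m n)" unfolding unitary_mat_def by simp
  show ?thesis
    using top_singular_prod_pow[OF U _ k, of "\<lambda>_. 1" 0] by (simp add: spectral_form_one[OF U])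
qed

lemma top_singular_prod_gram:
  assumes X: "X \<in> carrier_mat n n" and k: "k \<le> n"
  shows "top_singular_prod k (mat_adjoint X * X) = (top_singular_prod k X)\<^sup>2"
proof -
  obtain U s where U: "unitary_mat n U" and XX: "mat_adjoint X * X = spectral_form n U (\<lambda>i. (s i)\<^sup>2)"
    and s: "\<And>i. 0 \<le> s i" "\<And>i j. i \<le> j \<Longrightarrow> j < n \<Longrightarrow> s j \<le> s i" "singular_values X = map s [0..<n]"
    using singular_values_spectral[OF X] by metis
  have "singular_values (spectral_form n U s) = map s [0..<n]"
    using s by (intro singular_values_eqI[OF U])
      (auto simp: mat_adjoint_spectral_form[OF U] spectral_form_mult[OF U] power2_eq_square)
  then have "top_singular_prod k (spectral_form n U s) = top_singular_prod k X"
    unfolding top_singular_prod_def s(3) by simp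
  then show ?thesis unfolding XX using top_singular_prod_pow[OF U _ k, of s 2] s(1) by simp
qed

text \<open>From \<open>N\<^sub>k(X)\<^sup>2 = N\<^sub>k(X\<^sup>* X) \<le> N\<^sub>k(X\<^sup>*) N\<^sub>k(X)\<close> one cancels \<open>N\<^sub>k(X)\<close>; the same for \<open>X\<^sup>*\<close> gives equality.\<close>

lemma top_singular_prod_adjoint:
  assumes X: "X \<in> carrier_mat n n" and k: "k \<le> n"
  shows "top_singular_prod k (mat_adjoint X) = top_singular_prod k X"
proof -
  have le: "top_singular_prod k Y \<le> top_singular_prod k (mat_adjoint Y)" if Y: "Y \<in> carrier_mat n n" for Y
  proof -
    have Y': "mat_adjoint Y \<in> carrier_mat n n" using Y by (rule mat_adjoint_carrier)
    have "(top_singular_prod k Y)\<^sup>2 \<le> top_singular_prod k (mat_adjoint Y) * top_singular_prod k Y"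
      unfolding top_singular_prod_gram[OF Y k, symmetric] by (rule top_singular_prod_mult_le[OF Y' Y k])
    then show ?thesis
      using top_singular_prod_nonneg[OF Y k] top_singular_prod_nonneg[OF Y' k]
      by (cases "top_singular_prod k Y = 0") (auto simp: power2_eq_square)
  qed
  show ?thesis using le[OF X] le[OF mat_adjoint_carrier[OF X]] by simp
qed

lemma top_singular_prod_pos:
  assumes X: "X \<in> carrier_mat n n" and Y: "Y \<in> carrier_mat n n" and inv: "X * Y = 1\<^sub>m n" and k: "k \<le> n"
  shows "0 < top_singular_prod k X"
proof -
  have "1 \<le> top_singular_prod k X * top_singular_prod k Y"
    using top_singular_prod_mult_le[OF X Y k] top_singular_prod_one[OF k] inv by simp
  then show ?thesis using top_singular_prod_nonneg[OF X k] by (cases "top_singular_prod k X = 0") auto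
qed

lemma le_of_power_Suc_le:
  fixes x y c :: real
  assumes "0 \<le> y" and le: "\<And>m. x ^ Suc m \<le> c * y ^ m"
  shows "x \<le> y"
proof (rule ccontr)
  assume "\<not> x \<le> y"
  then have xy: "y < x" and x: "0 < x" using assms(1) by auto
  have c: "0 < c" using le[of 0] x by simp
  obtain m where m: "(y / x) ^ m < x / c"
    using real_arch_pow_inv[of "x / c" "y / x"] x c xy by auto
  have "x \<le> c * (y / x) ^ m"
    using le[of m] x by (simp add: power_divide field_simps)
  then show False using m c by (simp add: field_simps)
qed

lemma top_singular_prod_pow_le:
  assumes X: "X \<in> carrier_mat n n" and k: "k \<le> n"
  shows "top_singular_prod k (X ^\<^sub>m m) \<le> top_singular_prod k X ^ m"
proof (induction m)
  case 0
  then show ?case using X top_singular_prod_one[OF k] by simp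
next
  case (Suc m)
  have "top_singular_prod k (X ^\<^sub>m m * X) \<le> top_singular_prod k (X ^\<^sub>m m) * top_singular_prod k X"
    by (rule top_singular_prod_mult_le[OF pow_carrier_mat[OF X] X k])
  also have "\<dots> \<le> top_singular_prod k X ^ m * top_singular_prod k X"
    by (rule mult_right_mono[OF Suc.IH top_singular_prod_nonneg[OF X k]])
  finally show ?case by (simp add: mult.commute)
qed

text \<open>Since \<open>N\<^sub>k\<close> is multiplicative on powers of a positive semidefinite matrix and
  \<open>(PQ)\<^bsup>m+1\<^esup> = P (QP)\<^sup>m Q\<close>, the quantity \<open>N\<^sub>k(PQ)\<^bsup>m+1\<^esup>\<close> is at most a constant times \<open>N\<^sub>k(QP)\<^sup>m\<close>.
  Letting \<open>m\<close> grow removes the constant.\<close>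

lemma top_singular_prod_cyclic:
  assumes P: "P \<in> carrier_mat n n" and Q: "Q \<in> carrier_mat n n" and k: "k \<le> n"
    and U: "unitary_mat n U" and PQ: "P * Q = spectral_form n U d" and d: "\<And>i. i < n \<Longrightarrow> 0 \<le> d i"
  shows "top_singular_prod k (P * Q) \<le> top_singular_prod k (Q * P)"
proof (rule le_of_power_Suc_le)
  have QP: "Q * P \<in> carrier_mat n n" using P Q by simp
  show "0 \<le> top_singular_prod k (Q * P)" by (rule top_singular_prod_nonneg[OF QP k])
  fix m
  have shift: "(P * Q) ^\<^sub>m Suc m = P * ((Q * P) ^\<^sub>m m * Q)"
  proof (induction m)
    case (Suc m)
    have R: "(Q * P) ^\<^sub>m m \<in> carrier_mat n n" using pow_carrier_mat[OF QP] .
    have "(P * Q) ^\<^sub>m Suc (Suc m) = P * ((Q * P) ^\<^sub>m m * Q) * (P * Q)" using Suc by simp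
    also have "\<dots> = P * ((Q * P) ^\<^sub>m m * (Q * P) * Q)"
      using P Q R by (simp add: mat_assoc_square[where n=n] mult_carrier_mat[where n=n])
    finally show ?case by simp
  qed (use P Q in simp)
  have R: "(Q * P) ^\<^sub>m m \<in> carrier_mat n n" using pow_carrier_mat[OF QP] .
  have RQ: "(Q * P) ^\<^sub>m m * Q \<in> carrier_mat n n" using R Q by simp
  note nn = top_singular_prod_nonneg[OF P k] top_singular_prod_nonneg[OF Q k]
  have "top_singular_prod k (P * Q) ^ Suc m = top_singular_prod k ((P * Q) ^\<^sub>m Suc m)"
    unfolding PQ spectral_form_pow[OF U] by (rule top_singular_prod_pow[OF U _ k, symmetric]) (rule d)
  also have "\<dots> \<le> top_singular_prod k P * top_singular_prod k ((Q * P) ^\<^sub>m m * Q)"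
    unfolding shift by (rule top_singular_prod_mult_le[OF P RQ k])
  also have "\<dots> \<le> top_singular_prod k P * (top_singular_prod k (Q * P) ^ m * top_singular_prod k Q)"
    using nn by (intro mult_left_mono order_trans[OF top_singular_prod_mult_le[OF R Q k]] mult_right_mono
        top_singular_prod_pow_le[OF QP k]) auto
  finally show "top_singular_prod k (P * Q) ^ Suc m \<le>
      (top_singular_prod k P * top_singular_prod k Q) * top_singular_prod k (Q * P) ^ m"
    by (simp add: mult_ac)
qed

text \<open>Boundedness takes the place of continuity. After division by the chord, the function \<open>g\<close> equals \<open>1\<close> at
  both ends, and every point is the midpoint of an end and another point. So \<open>g\<^sup>2 \<le> S\<close>
  for \<open>S = sup g\<close>, whence \<open>S\<^sup>2 \<le> S\<close> and \<open>S \<le> 1\<close>.\<close>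

lemma log_midpoint_convex_le_chord:
  fixes \<phi> :: "real \<Rightarrow> real"
  assumes pos: "\<And>s. 0 \<le> s \<Longrightarrow> s \<le> 1 \<Longrightarrow> 0 < \<phi> s" and bound: "\<And>s. 0 \<le> s \<Longrightarrow> s \<le> 1 \<Longrightarrow> \<phi> s \<le> M"
    and zero: "\<phi> 0 = 1"
    and mid: "\<And>s t. 0 \<le> s \<Longrightarrow> s \<le> 1 \<Longrightarrow> 0 \<le> t \<Longrightarrow> t \<le> 1 \<Longrightarrow> (\<phi> ((s + t) / 2))\<^sup>2 \<le> \<phi> s * \<phi> t"
    and s: "0 \<le> s" "s \<le> 1"
  shows "\<phi> s \<le> \<phi> 1 powr s"
proof -
  define y where "y = \<phi> 1"
  have y: "0 < y" unfolding y_def using pos by simp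
  define g where "g s = \<phi> s * y powr (- s)" for s
  have g01: "g 0 = 1" "g 1 = 1" unfolding g_def using y zero by (auto simp: y_def[symmetric] powr_minus)
  have gpos: "0 < g s" if "0 \<le> s" "s \<le> 1" for s unfolding g_def using pos[OF that] y by simp
  have gmid: "(g ((s + t) / 2))\<^sup>2 \<le> g s * g t" if "0 \<le> s" "s \<le> 1" "0 \<le> t" "t \<le> 1" for s t
  proof -
    have "(y powr (- ((s + t) / 2)))\<^sup>2 = y powr (- s) * y powr (- t)"
      by (simp add: power2_eq_square flip: powr_add)
    then have "(g ((s + t) / 2))\<^sup>2 = (\<phi> ((s + t) / 2))\<^sup>2 * (y powr (- s) * y powr (- t))"
      unfolding g_def by (simp add: power_mult_distrib)
    also have "\<dots> \<le> (\<phi> s * \<phi> t) * (y powr (- s) * y powr (- t))"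
      using mid[OF that] y by (intro mult_right_mono) auto
    finally show ?thesis unfolding g_def by (simp add: mult_ac)
  qed
  have gbound: "g s \<le> M * max 1 (y powr (-1))" if "0 \<le> s" "s \<le> 1" for s
  proof -
    have "y powr (- s) \<le> max 1 (y powr (-1))"
    proof (cases "1 \<le> y")
      case True
      then have "y powr (- s) \<le> y powr 0" using that by (intro powr_mono) auto
      then show ?thesis using y by simp
    next
      case False
      then have "y powr (- s) \<le> y powr (-1)" using that y by (intro powr_mono') auto
      then show ?thesis by simp
    qed
    then show ?thesis unfolding g_def
      using bound[OF that] pos[OF that] by (intro mult_mono) auto
  qed
  define S where "S = Sup (g ` {0..1})"
  have bdd: "bdd_above (g ` {0..1})" by (rule bdd_aboveI2, rule gbound) auto
  have gS: "g r \<le> S" if "0 \<le> r" "r \<le> 1" for r unfolding S_def using that bdd by (intro cSup_upper) auto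
  have S1: "1 \<le> S" using gS[of 0] g01 by simp
  have sq: "(g r)\<^sup>2 \<le> S" if r: "0 \<le> r" "r \<le> 1" for r
  proof (cases "r \<le> 1 / 2")
    case True
    then show ?thesis using gmid[of 0 "2 * r"] gS[of "2 * r"] r g01 by simp
  next
    case False
    then show ?thesis using gmid[of "2 * r - 1" 1] gS[of "2 * r - 1"] r g01 by simp
  qed
  have "S \<le> sqrt S"
    unfolding S_def using sq gpos
    by (intro cSup_least) (auto intro!: real_le_rsqrt simp flip: S_def)
  then have "S\<^sup>2 \<le> (sqrt S)\<^sup>2" using S1 by (intro power_mono) auto
  then have "S * S \<le> S" using S1 by (simp add: power2_eq_square)
  then have "S \<le> 1" using S1 by (simp add: mult_le_cancel_left1)
  then have "g s \<le> 1" using gS[OF s] by simp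
  then show ?thesis unfolding g_def y_def[symmetric] using y by (simp add: powr_minus field_simps)
qed

section \<open>Powers of positive definite matrices\<close>

lemma cscalar_prod_adjoint:
  fixes M :: "complex mat"
  assumes M: "M \<in> carrier_mat n n" and v: "v \<in> carrier_vec n" and w: "w \<in> carrier_vec n"
  shows "(mat_adjoint M *\<^sub>v w) \<bullet>c v = w \<bullet>c (M *\<^sub>v v)"
proof -
  have "(mat_adjoint M *\<^sub>v w) \<bullet>c v = (\<Sum>i<n. \<Sum>j<n. cnj (M $$ (j,i)) * w $ j * cnj (v $ i))"
    using M v w by (auto simp: scalar_prod_def lessThan_atLeast0 sum_distrib_right intro!: sum.cong)
  also have "\<dots> = (\<Sum>j<n. \<Sum>i<n. cnj (M $$ (j,i)) * w $ j * cnj (v $ i))" by (rule sum.swap)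
  also have "\<dots> = w \<bullet>c (M *\<^sub>v v)"
    using M v w by (auto simp: scalar_prod_def lessThan_atLeast0 sum_distrib_left cnj_sum mult_ac intro!: sum.cong)
  finally show ?thesis .
qed

lemma positive_definite_congruence:
  assumes B: "positive_definite n B" and M: "M \<in> carrier_mat n n" and N: "N \<in> carrier_mat n n"
    and inv: "N * M = 1\<^sub>m n"
  shows "positive_definite n (mat_adjoint M * B * M)"
proof -
  have Bc: "B \<in> carrier_mat n n" and Bh: "mat_adjoint B = B" using B unfolding positive_definite_def by auto
  have M': "mat_adjoint M \<in> carrier_mat n n" using M by (rule mat_adjoint_carrier)
  have MB: "mat_adjoint M * B \<in> carrier_mat n n" using M' Bc by simp
  have "mat_adjoint (mat_adjoint M * B * M) = mat_adjoint M * B * M"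
    unfolding mat_adjoint_mult[OF MB M] mat_adjoint_mult[OF M' Bc] Bh
    using M M' Bc by (simp add: mat_assoc_square[where n=n])
  moreover have "Re ((mat_adjoint M * B * M *\<^sub>v v) \<bullet>c v) > 0"
    if v: "v \<in> carrier_vec n" and v0: "v \<noteq> 0\<^sub>v n" for v
  proof -
    have Mv: "M *\<^sub>v v \<in> carrier_vec n" using M v by simp
    have "M *\<^sub>v v \<noteq> 0\<^sub>v n"
    proof
      assume "M *\<^sub>v v = 0\<^sub>v n"
      then have "N *\<^sub>v (M *\<^sub>v v) = 0\<^sub>v n" using N by (auto intro!: eq_vecI)
      then show False using v v0 assoc_mult_mat_vec[OF N M v] inv by simp
    qed
    then have "Re ((B *\<^sub>v (M *\<^sub>v v)) \<bullet>c (M *\<^sub>v v)) > 0"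
      using B Mv unfolding positive_definite_def by blast
    moreover have "mat_adjoint M * B * M *\<^sub>v v = mat_adjoint M *\<^sub>v (B *\<^sub>v (M *\<^sub>v v))"
      using M M' Bc v by (simp add: assoc_mult_mat_vec[of _ n n _ n])
    ultimately show ?thesis
      using cscalar_prod_adjoint[OF M v, of "B *\<^sub>v (M *\<^sub>v v)"] Bc Mv by simp
  qed
  ultimately show ?thesis unfolding positive_definite_def using M' Bc M by auto
qed

text \<open>Positivity of \<open>d\<close> is arranged for all indices, also from \<open>n\<close> on, so that
  power laws for \<open>d\<close> need no case distinction.\<close>

lemma positive_definite_spectral:
  assumes A: "positive_definite n A"
  obtains U d where "unitary_mat n U" "A = spectral_form n U d" "\<And>i. 0 < (d i :: real)"
    "\<And>r. mat_powr A r = spectral_form n U (\<lambda>i. d i powr r)"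
proof -
  have Ac: "A \<in> carrier_mat n n" and Ah: "mat_adjoint A = A" using A unfolding positive_definite_def by auto
  obtain U e where U: "unitary_mat n U" and Ae: "A = spectral_form n U e"
    using hermitian_spectral_form_exists[OF Ac Ah] by (elim exE conjE)
  note u = unitary_matD[OF U]
  have pos: "0 < e i" if i: "i < n" for i
  proof -
    let ?v = "col U i"
    have v: "?v \<in> carrier_vec n" using u(1) by auto
    have "mat_adjoint U * A * U = (mat_adjoint U * U) * mat_diag n (\<lambda>i. complex_of_real (e i)) * (mat_adjoint U * U)"
      unfolding Ae spectral_form_def
      using u(1,2) by (simp add: mat_assoc_square[where n=n] mult_carrier_mat[where n=n])
    then have D: "mat_adjoint U * A * U = mat_diag n (\<lambda>i. complex_of_real (e i))"
      unfolding u(3) by (simp add: left_mult_one_mat[where nr=n and nc=n] right_mult_one_mat[where nr=n and nc=n])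
    have "?v \<bullet>c ?v = 1"
    proof -
      have "?v \<bullet>c ?v = (mat_adjoint U * U) $$ (i,i)"
        using u(1) i by (auto simp: scalar_prod_def mult.commute intro!: sum.cong)
      then show ?thesis unfolding u(3) using i by simp
    qed
    then have "?v \<noteq> 0\<^sub>v n" by auto
    then have "0 < Re ((A *\<^sub>v ?v) \<bullet>c ?v)" using A v unfolding positive_definite_def by blast
    also have "(A *\<^sub>v ?v) \<bullet>c ?v = (mat_adjoint U * (A * U)) $$ (i,i)"
      using u(1) i Ac by (auto simp: scalar_prod_def mult.commute intro!: sum.cong)
    also have "\<dots> = complex_of_real (e i)"
      using D i u Ac by (simp add: mat_assoc_square[where n=n] mat_diag_def)
    finally show ?thesis by simp
  qed
  define d where "d i = (if i < n then e i else 1)" for i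
  have Ad: "A = spectral_form n U d"
    unfolding Ae by (intro eq_matI)
      (auto simp: spectral_form_index[OF U] d_def carrier_matD[OF spectral_form_carrier[OF U]])
  have "0 < d i" for i unfolding d_def using pos by auto
  moreover have "mat_powr A r = spectral_form n U (\<lambda>i. d i powr r)" for r
    unfolding Ad by (rule mat_powr_spectral_form[OF U])
  ultimately show ?thesis using that[OF U Ad] by blast
qed

text \<open>The matrix is a congruence transform of the identity by its own square root.\<close>

lemma spectral_positive_definite:
  assumes U: "unitary_mat n U" and d: "\<And>i. 0 < (d i :: real)"
  shows "positive_definite n (spectral_form n U d)"
proof -
  note u = unitary_matD[OF U]
  have one: "positive_definite n (1\<^sub>m n)"
    unfolding positive_definite_def
  proof (intro conjI ballI impI)
    fix v :: "complex vec" assume v: "v \<in> carrier_vec n" "v \<noteq> 0\<^sub>v n"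
    have "0 < v \<bullet>c v" using conjugate_square_greater_0_vec[OF v(1)] v by simp
    then show "0 < Re ((1\<^sub>m n *\<^sub>v v) \<bullet>c v)" using v by (simp add: less_complex_def)
  qed auto
  let ?S = "\<lambda>r. spectral_form n U (\<lambda>i. d i powr r)"
  have c: "?S r \<in> carrier_mat n n" for r by (rule spectral_form_carrier[OF U])
  have add: "?S r * ?S s = ?S (r + s)" for r s
    unfolding spectral_form_mult[OF U] powr_add ..
  have "d i powr 0 = 1" for i using d[of i] by simp
  then have zero: "?S 0 = 1\<^sub>m n" by (simp only: spectral_form_one[OF U])
  have "positive_definite n (mat_adjoint (?S (1/2)) * 1\<^sub>m n * ?S (1/2))"
    by (rule positive_definite_congruence[OF one c c[of "- (1/2)"]]) (simp only: add left_minus zero)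
  also have "mat_adjoint (?S (1/2)) * 1\<^sub>m n * ?S (1/2) = spectral_form n U d"
    using d c[of "1/2"] add[of "1/2" "1/2"] by (simp add: mat_adjoint_spectral_form[OF U] less_imp_le)
  finally show ?thesis .
qed

context
  fixes n A
  assumes A: "positive_definite n A"
begin

lemma mat_powr_carrier: "mat_powr A r \<in> carrier_mat n n"
  by (rule positive_definite_spectral[OF A]) (metis spectral_form_carrier)

lemma mat_adjoint_mat_powr: "mat_adjoint (mat_powr A r) = mat_powr A r"
  by (rule positive_definite_spectral[OF A]) (metis mat_adjoint_spectral_form)

lemma mat_powr_add: "mat_powr A r * mat_powr A s = mat_powr A (r + s)"
proof (rule positive_definite_spectral[OF A])
  fix U d assume *: "unitary_mat n U" "\<And>r. mat_powr A r = spectral_form n U (\<lambda>i. d i powr r)"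
  show ?thesis unfolding *(2) spectral_form_mult[OF *(1)] powr_add ..
qed

lemma mat_powr_zero: "mat_powr A 0 = 1\<^sub>m n"
proof (rule positive_definite_spectral[OF A])
  fix U d assume *: "unitary_mat n U" "\<And>i. 0 < (d i :: real)" "\<And>r. mat_powr A r = spectral_form n U (\<lambda>i. d i powr r)"
  have "d i powr 0 = 1" for i using *(2)[of i] by simp
  then show ?thesis unfolding *(3) by (simp only: spectral_form_one[OF *(1)])
qed

lemma mat_powr_one: "mat_powr A 1 = A"
proof (rule positive_definite_spectral[OF A])
  fix U d assume *: "unitary_mat n U" "A = spectral_form n U d" "\<And>i. 0 < (d i :: real)"
    "\<And>r. mat_powr A r = spectral_form n U (\<lambda>i. d i powr r)"
  have "d i powr 1 = d i" for i using *(3)[of i] by simp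
  then show ?thesis unfolding *(4) by (simp only: *(2)[symmetric])
qed

lemma positive_definite_mat_powr: "positive_definite n (mat_powr A r)"
proof (rule positive_definite_spectral[OF A])
  fix U d assume *: "unitary_mat n U" "\<And>i. 0 < (d i :: real)" "\<And>r. mat_powr A r = spectral_form n U (\<lambda>i. d i powr r)"
  have "0 < d i powr r" for i using *(2)[of i] by simp
  then show ?thesis unfolding *(3) by (rule spectral_positive_definite[OF *(1)])
qed

lemma mat_powr_powr: "mat_powr (mat_powr A r) s = mat_powr A (r * s)"
proof (rule positive_definite_spectral[OF A])
  fix U d assume *: "unitary_mat n U" "\<And>r. mat_powr A r = spectral_form n U (\<lambda>i. d i powr r)"
  show ?thesis unfolding *(2) mat_powr_spectral_form[OF *(1)] powr_powr ..
qed

lemma top_singular_prod_mat_powr: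
  assumes k: "k \<le> n" and r: "0 \<le> r"
  shows "top_singular_prod k (mat_powr A r) = top_singular_prod k A powr r"
proof (rule positive_definite_spectral[OF A])
  fix U d assume *: "unitary_mat n U" "A = spectral_form n U d" "\<And>i. 0 < (d i :: real)"
    "\<And>r. mat_powr A r = spectral_form n U (\<lambda>i. d i powr r)"
  show ?thesis unfolding *(4) unfolding *(2)
    by (rule top_singular_prod_powr[OF *(1) _ k r]) (use *(3) in \<open>simp add: less_imp_le\<close>)
qed

end

section \<open>The Cordes inequality\<close>

lemma top_singular_prod_powr_mult_pos:
  assumes A: "positive_definite n A" and B: "positive_definite n B" and k: "k \<le> n"
  shows "0 < top_singular_prod k (mat_powr A s * mat_powr B t)"
proof (rule top_singular_prod_pos[OF _ _ _ k])
  note c = mat_powr_carrier[OF A] mat_powr_carrier[OF B]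
  show "mat_powr A s * mat_powr B t * (mat_powr B (- t) * mat_powr A (- s)) = 1\<^sub>m n"
  proof -
    have "mat_powr A s * mat_powr B t * (mat_powr B (- t) * mat_powr A (- s)) =
      mat_powr A s * ((mat_powr B t * mat_powr B (- t)) * mat_powr A (- s))"
      using c by (simp add: mat_assoc_square[where n=n] mult_carrier_mat[where n=n])
    then show ?thesis using c by (simp add: left_mult_one_mat[OF c(1)] mat_powr_add[OF A] mat_powr_add[OF B] mat_powr_zero[OF A] mat_powr_zero[OF B])
  qed
qed (rule mult_carrier_mat[OF mat_powr_carrier[OF A] mat_powr_carrier[OF B]],
  rule mult_carrier_mat[OF mat_powr_carrier[OF B] mat_powr_carrier[OF A]])

text \<open>With \<open>p = (s + t)/2\<close> and \<open>X = A\<^sup>p B\<^sup>p\<close>, the positive semidefinite matrix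
  \<open>X\<^sup>* X = (B\<^sup>p A\<^sup>t)(A\<^sup>s B\<^sup>p)\<close> turns under a cyclic shift of its two factors into
  \<open>(A\<^sup>s B\<^sup>s)(B\<^sup>t A\<^sup>t)\<close>, and \<open>B\<^sup>t A\<^sup>t\<close> is the adjoint of \<open>A\<^sup>t B\<^sup>t\<close>.\<close>

lemma top_singular_prod_midpoint:
  assumes A: "positive_definite n A" and B: "positive_definite n B" and k: "k \<le> n"
  shows "(top_singular_prod k (mat_powr A ((s + t) / 2) * mat_powr B ((s + t) / 2)))\<^sup>2
    \<le> top_singular_prod k (mat_powr A s * mat_powr B s) * top_singular_prod k (mat_powr A t * mat_powr B t)"
proof -
  define p where "p = (s + t) / 2"
  have pp: "p + p = t + s" "p + p = s + t" unfolding p_def by simp_all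
  note c = mat_powr_carrier[OF A] mat_powr_carrier[OF B]
  note adj = mat_adjoint_mult[OF c(1) c(2)] mat_adjoint_mat_powr[OF A] mat_adjoint_mat_powr[OF B]
  note assoc = mat_assoc_square[where n=n] mult_carrier_mat[where n=n]
  define X where "X = mat_powr A p * mat_powr B p"
  have X: "X \<in> carrier_mat n n" unfolding X_def by (rule mult_carrier_mat[OF c])
  define P where "P = mat_powr B p * mat_powr A t"
  define Q where "Q = mat_powr A s * mat_powr B p"
  have P: "P \<in> carrier_mat n n" and Q: "Q \<in> carrier_mat n n" unfolding P_def Q_def
    by (rule mult_carrier_mat[OF c(2) c(1)], rule mult_carrier_mat[OF c])
  have "mat_adjoint X * X = mat_powr B p * (mat_powr A p * mat_powr A p) * mat_powr B p"
    unfolding X_def adj using c by (simp add: assoc)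
  also have "mat_powr A p * mat_powr A p = mat_powr A t * mat_powr A s"
    unfolding mat_powr_add[OF A] pp(1) ..
  finally have XPQ: "mat_adjoint X * X = P * Q"
    unfolding P_def Q_def using c by (simp add: assoc)
  have "Q * P = mat_powr A s * (mat_powr B p * mat_powr B p) * mat_powr A t"
    unfolding P_def Q_def using c by (simp add: assoc)
  also have "mat_powr B p * mat_powr B p = mat_powr B s * mat_powr B t"
    unfolding mat_powr_add[OF B] pp(2) ..
  finally have QP: "Q * P = (mat_powr A s * mat_powr B s) * mat_adjoint (mat_powr A t * mat_powr B t)"
    unfolding adj using c by (simp add: assoc)
  obtain U \<sigma> where U: "unitary_mat n U" and XX: "mat_adjoint X * X = spectral_form n U (\<lambda>i. (\<sigma> i)\<^sup>2)"
    using singular_values_spectral[OF X] by metis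
  have AtBt: "mat_powr A r * mat_powr B r \<in> carrier_mat n n" for r by (rule mult_carrier_mat[OF c])
  have "(top_singular_prod k X)\<^sup>2 = top_singular_prod k (P * Q)"
    unfolding top_singular_prod_gram[OF X k, symmetric] XPQ ..
  also have "\<dots> \<le> top_singular_prod k (Q * P)"
    by (rule top_singular_prod_cyclic[OF P Q k U]) (use XX XPQ in auto)
  also have "\<dots> \<le> top_singular_prod k (mat_powr A s * mat_powr B s) *
      top_singular_prod k (mat_adjoint (mat_powr A t * mat_powr B t))"
    unfolding QP by (rule top_singular_prod_mult_le[OF AtBt mat_adjoint_carrier[OF AtBt] k])
  finally show ?thesis
    unfolding top_singular_prod_adjoint[OF AtBt k] X_def p_def .
qed

theorem top_singular_prod_cordes:
  assumes A: "positive_definite n A" and B: "positive_definite n B" and k: "k \<le> n"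
    and s: "0 \<le> s" "s \<le> 1"
  shows "top_singular_prod k (mat_powr A s * mat_powr B s) \<le> top_singular_prod k (A * B) powr s"
proof -
  define \<phi> where "\<phi> s = top_singular_prod k (mat_powr A s * mat_powr B s)" for s
  have c: "A \<in> carrier_mat n n" "B \<in> carrier_mat n n" using A B unfolding positive_definite_def by auto
  have powr_le: "x powr r \<le> max 1 x" if "0 \<le> x" "0 \<le> r" "r \<le> 1" for x r :: real
  proof (cases "x \<le> 1")
    case True
    then show ?thesis using that powr_mono2[of r x 1] by simp
  next
    case False
    then show ?thesis using that powr_mono[of r 1 x] by simp
  qed
  have "\<phi> s \<le> \<phi> 1 powr s"
  proof (rule log_midpoint_convex_le_chord[OF _ _ _ _ s])
    show "0 < \<phi> r" for r unfolding \<phi>_def by (rule top_singular_prod_powr_mult_pos[OF A B k])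
    show "\<phi> 0 = 1" unfolding \<phi>_def by (simp add: mat_powr_zero[OF A] mat_powr_zero[OF B] top_singular_prod_one[OF k])
    show "(\<phi> ((r + t) / 2))\<^sup>2 \<le> \<phi> r * \<phi> t" for r t
      unfolding \<phi>_def by (rule top_singular_prod_midpoint[OF A B k])
    fix r :: real assume r: "0 \<le> r" "r \<le> 1"
    have "\<phi> r \<le> top_singular_prod k (mat_powr A r) * top_singular_prod k (mat_powr B r)"
      unfolding \<phi>_def by (rule top_singular_prod_mult_le[OF mat_powr_carrier[OF A] mat_powr_carrier[OF B] k])
    also have "\<dots> = top_singular_prod k A powr r * top_singular_prod k B powr r"
      using top_singular_prod_mat_powr[OF A k r(1)] top_singular_prod_mat_powr[OF B k r(1)] by simp
    also have "\<dots> \<le> max 1 (top_singular_prod k A) * max 1 (top_singular_prod k B)"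
      using r top_singular_prod_nonneg[OF c(1) k] top_singular_prod_nonneg[OF c(2) k]
      by (intro mult_mono powr_le) auto
    finally show "\<phi> r \<le> max 1 (top_singular_prod k A) * max 1 (top_singular_prod k B)" .
  qed
  then show ?thesis unfolding \<phi>_def mat_powr_one[OF A] mat_powr_one[OF B] .
qed

section \<open>Determinants and the case of all singular values\<close>

lemma det_mat_adjoint:
  assumes X: "X \<in> carrier_mat n n"
  shows "det (mat_adjoint X) = cnj (det X)"
proof -
  have "det (mat_adjoint X) = (\<Sum>p | p permutes {0..<n}. signof p * (\<Prod>j<n. mat_adjoint X $$ (p j, j)))"
    by (rule det_col[OF mat_adjoint_carrier[OF X]])
  also have "\<dots> = (\<Sum>p | p permutes {0..<n}. cnj (signof p * (\<Prod>j\<in>{0..<n}. X $$ (j, p j))))"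
  proof (rule sum.cong[OF refl])
    fix p assume "p \<in> {p. p permutes {0..<n}}"
    then have p: "p j < n" if "j < n" for j using permutes_in_image[of p "{0..<n}" j] that by auto
    show "signof p * (\<Prod>j<n. mat_adjoint X $$ (p j, j)) = cnj (signof p * (\<Prod>j\<in>{0..<n}. X $$ (j, p j)))"
      using X p by (simp add: cnj_prod lessThan_atLeast0)
  qed
  also have "\<dots> = cnj (det X)"
    unfolding det_def'[OF X] by (simp add: cnj_sum)
  finally show ?thesis .
qed

lemma det_spectral_form:
  assumes U: "unitary_mat n U"
  shows "det (spectral_form n U d) = complex_of_real (\<Prod>i<n. d i)"
proof -
  note u = unitary_matD[OF U]
  let ?D = "mat_diag n (\<lambda>i. complex_of_real (d i))"
  have D: "?D \<in> carrier_mat n n" by simp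
  have "det (spectral_form n U d) = det ?D * (det U * det (mat_adjoint U))"
    unfolding spectral_form_def det_mult[OF mult_carrier_mat[OF u(1) D] u(2)] det_mult[OF u(1) D] by simp
  also have "det U * det (mat_adjoint U) = 1"
    unfolding det_mult[OF u(1,2), symmetric] u(4) by simp
  also have "det ?D = (\<Prod>i<n. complex_of_real (d i))"
    by (subst det_upper_triangular[of _ n]) (auto simp: mat_diag_def diag_mat_def prod.list_conv_set_nth lessThan_atLeast0)
  finally show ?thesis by simp
qed

lemma top_singular_prod_eq_det:
  assumes X: "X \<in> carrier_mat n n"
  shows "top_singular_prod n X = cmod (det X)"
proof -
  obtain U s where U: "unitary_mat n U" and XX: "mat_adjoint X * X = spectral_form n U (\<lambda>i. (s i)\<^sup>2)"
    and s: "singular_values X = map s [0..<n]"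
    using singular_values_spectral[OF X] by metis
  have "complex_of_real ((\<Prod>i<n. s i)\<^sup>2) = det (mat_adjoint X * X)"
    unfolding XX det_spectral_form[OF U] prod_power_distrib ..
  also have "\<dots> = complex_of_real ((cmod (det X))\<^sup>2)"
    unfolding det_mult[OF mat_adjoint_carrier[OF X] X] det_mat_adjoint[OF X] complex_norm_square
    by (rule mult.commute)
  finally have "(\<Prod>i<n. s i)\<^sup>2 = (cmod (det X))\<^sup>2" unfolding of_real_eq_iff .
  moreover have "top_singular_prod n X = (\<Prod>i<n. s i)" unfolding top_singular_prod_def s by simp
  ultimately show ?thesis using top_singular_prod_nonneg[OF X order_refl] by simp
qed

lemma log_majorized_singular_values_iff:
  assumes "X \<in> carrier_mat n n" "Y \<in> carrier_mat n n"
  shows "singular_values X \<prec>\<^sub>l\<^sub>o\<^sub>g singular_values Y \<longleftrightarrow>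
    (\<forall>k\<in>{1..<n}. top_singular_prod k X \<le> top_singular_prod k Y) \<and> cmod (det X) = cmod (det Y)"
  unfolding log_majorized_def top_singular_prod_eq_det[OF assms(1), symmetric]
    top_singular_prod_eq_det[OF assms(2), symmetric]
  using assms by (simp add: top_singular_prod_def length_singular_values)

lemma positive_definite_carrier: "positive_definite n A \<Longrightarrow> A \<in> carrier_mat n n"
  unfolding positive_definite_def by simp

lemma positive_definite_det_mat_powr:
  assumes A: "positive_definite n A"
  obtains a where "0 < a" "\<And>r. det (mat_powr A r) = complex_of_real (a powr r)"
proof (rule positive_definite_spectral[OF A])
  fix U d assume *: "unitary_mat n U" "\<And>i. 0 < (d i :: real)" "\<And>r. mat_powr A r = spectral_form n U (\<lambda>i. d i powr r)"
  have "0 < (\<Prod>i<n. d i)" using *(2) by (intro prod_pos) auto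
  then show ?thesis
    by (rule that) (simp only: *(3) det_spectral_form[OF *(1)] prod_powr_distrib)
qed

section \<open>The weighted geometric mean\<close>

lemma positive_definite_sandwich:
  assumes A: "positive_definite n A" and B: "positive_definite n B"
  shows "positive_definite n (mat_powr A (-1/2) * B * mat_powr A (-1/2))"
proof -
  have "mat_powr A (1/2) * mat_powr A (-1/2) = 1\<^sub>m n"
    unfolding mat_powr_add[OF A] by (simp add: mat_powr_zero[OF A])
  from positive_definite_congruence[OF B mat_powr_carrier[OF A] mat_powr_carrier[OF A] this]
  show ?thesis unfolding mat_adjoint_mat_powr[OF A] .
qed

lemma mat_powr_add_left:
  assumes A: "positive_definite n A" and Z: "Z \<in> carrier_mat n n"
  shows "mat_powr A r * (mat_powr A s * Z) = mat_powr A (r + s) * Z"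
  using assoc_mult_mat[OF mat_powr_carrier[OF A, of r] mat_powr_carrier[OF A, of s] Z]
  by (simp add: mat_powr_add[OF A])

lemma sandwich_inverse:
  assumes A: "positive_definite n A" and B: "positive_definite n B"
  shows "mat_powr A (1/2) * (mat_powr A (-1/2) * B * mat_powr A (-1/2)) * mat_powr A (1/2) = B"
  using mat_powr_carrier[OF A] positive_definite_carrier[OF B]
  by (simp add: mat_assoc_square[where n=n] mult_carrier_mat[where n=n] mat_powr_add_left[OF A]
      mat_powr_add[OF A] mat_powr_zero[OF A])

lemma mat_powr_unitary_conjugate:
  assumes C: "positive_definite n C" and W: "unitary_mat n W"
  shows "mat_powr (W * C * mat_adjoint W) r = W * mat_powr C r * mat_adjoint W"
proof (rule positive_definite_spectral[OF C])
  fix U d assume *: "unitary_mat n U" "C = spectral_form n U d" "\<And>r. mat_powr C r = spectral_form n U (\<lambda>i. d i powr r)"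
  show ?thesis unfolding *(3) unfolding *(2) spectral_form_conjugate[OF W *(1), symmetric]
    by (rule mat_powr_spectral_form[OF unitary_mat_mult[OF W *(1)]])
qed

text \<open>\<open>W = B\<^bsup>1/2\<^esup> A\<^bsup>-1/2\<^esup> C\<^bsup>-1/2\<^esup>\<close> is the unitary factor in the polar decomposition of
  \<open>B\<^bsup>1/2\<^esup> A\<^bsup>-1/2\<^esup>\<close>. It conjugates \<open>C\<^bsup>-1\<^esup>\<close> into \<open>B\<^bsup>-1/2\<^esup> A B\<^bsup>-1/2\<^esup>\<close>, hence also their powers, and
  \<open>B\<^bsup>1/2\<^esup> W = A\<^bsup>1/2\<^esup> C\<^bsup>1/2\<^esup>\<close> absorbs it on both sides.\<close>

theorem geometric_mean_swap:
  assumes A: "positive_definite n A" and B: "positive_definite n B"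
  shows "geometric_mean (1 - t) B A = geometric_mean t A B"
proof -
  define C where "C = mat_powr A (-1/2) * B * mat_powr A (-1/2)"
  have C: "positive_definite n C" unfolding C_def by (rule positive_definite_sandwich[OF A B])
  note c = mat_powr_carrier[OF A] mat_powr_carrier[OF B] mat_powr_carrier[OF C]
  note Bc = positive_definite_carrier[OF B] and Ac = positive_definite_carrier[OF A] and Cc = positive_definite_carrier[OF C]
  note alg = mat_assoc_square[where n=n] mult_carrier_mat[where n=n]
    mat_powr_add_left[OF A] mat_powr_add[OF A] mat_powr_zero[OF A]
    mat_powr_add_left[OF B] mat_powr_add[OF B] mat_powr_zero[OF B]
    mat_powr_add_left[OF C] mat_powr_add[OF C] mat_powr_zero[OF C]
    left_mult_one_mat[where nr=n and nc=n] right_mult_one_mat[where nr=n and nc=n]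
  have BC: "mat_powr B 1 = mat_powr A (1/2) * (mat_powr C 1 * mat_powr A (1/2))"
    using sandwich_inverse[OF A B, folded C_def] c Cc
    by (simp add: mat_powr_one[OF B] mat_powr_one[OF C] alg)
  have CB: "mat_powr C 1 = mat_powr A (-1/2) * (mat_powr B 1 * mat_powr A (-1/2))"
    unfolding mat_powr_one[OF B] mat_powr_one[OF C] unfolding C_def using c Bc by (simp add: alg)
  define W where "W = mat_powr B (1/2) * (mat_powr A (-1/2) * mat_powr C (-1/2))"
  have Wadj: "mat_adjoint W = mat_powr C (-1/2) * (mat_powr A (-1/2) * mat_powr B (1/2))"
    unfolding W_def mat_adjoint_mult[OF c(2) mult_carrier_mat[OF c(1) c(3)]] mat_adjoint_mult[OF c(1) c(3)]
      mat_adjoint_mat_powr[OF A] mat_adjoint_mat_powr[OF B] mat_adjoint_mat_powr[OF C]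
    using c by (simp add: alg)
  have Wc: "W \<in> carrier_mat n n" unfolding W_def using c by (simp add: alg)
  have "mat_adjoint W * W = mat_powr C (-1/2) * ((mat_powr A (-1/2) * (mat_powr B 1 * mat_powr A (-1/2))) * mat_powr C (-1/2))"
    unfolding Wadj unfolding W_def using c by (simp add: alg)
  also have "\<dots> = 1\<^sub>m n" unfolding CB[symmetric] using c by (simp add: alg)
  finally have W: "unitary_mat n W" unfolding unitary_mat_def using Wc by simp
  \<comment> \<open>The expression on the left is the inverse of \<open>B = A\<^bsup>1/2\<^esup> C A\<^bsup>1/2\<^esup>\<close>.\<close>
  have Binv: "mat_powr A (-1/2) * (mat_powr C (-1) * mat_powr A (-1/2)) = mat_powr B (-1)" (is "?X = _")
  proof -
    have X: "?X \<in> carrier_mat n n" using c by (simp add: alg)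
    have "mat_powr B 1 * ?X = 1\<^sub>m n" unfolding BC using c by (simp add: alg)
    then have "mat_powr B (-1) * (mat_powr B 1 * ?X) = mat_powr B (-1)" using c by (simp add: alg)
    then show ?thesis using X by (simp add: alg)
  qed
  have E: "mat_powr B (-1/2) * A * mat_powr B (-1/2) = W * mat_powr C (-1) * mat_adjoint W"
  proof -
    have "W * mat_powr C (-1) * mat_adjoint W =
      mat_powr B (1/2) * ((mat_powr A (-1/2) * (mat_powr C (-1) * mat_powr A (-1/2))) *
        (mat_powr A 1 * ((mat_powr A (-1/2) * (mat_powr C (-1) * mat_powr A (-1/2))) * mat_powr B (1/2))))"
      unfolding Wadj unfolding W_def using c by (simp add: alg)
    also have "\<dots> = mat_powr B (-1/2) * A * mat_powr B (-1/2)"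
      unfolding Binv using c Ac by (simp add: alg mat_powr_one[OF A])
    finally show ?thesis ..
  qed
  have BW: "mat_powr B (1/2) * W = mat_powr A (1/2) * mat_powr C (1/2)"
  proof -
    have "mat_powr B (1/2) * W = mat_powr B 1 * (mat_powr A (-1/2) * mat_powr C (-1/2))"
      unfolding W_def using c by (simp add: alg)
    also have "\<dots> = mat_powr A (1/2) * mat_powr C (1/2)"
      unfolding BC using c by (simp add: alg)
    finally show ?thesis .
  qed
  have WB: "mat_adjoint W * mat_powr B (1/2) = mat_powr C (1/2) * mat_powr A (1/2)"
  proof -
    have "mat_adjoint (mat_powr B (1/2) * W) = mat_adjoint W * mat_powr B (1/2)"
      unfolding mat_adjoint_mult[OF c(2) Wc] mat_adjoint_mat_powr[OF B] ..
    then show ?thesis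
      unfolding BW mat_adjoint_mult[OF c(1) c(3)] mat_adjoint_mat_powr[OF A] mat_adjoint_mat_powr[OF C] by simp
  qed
  have "mat_powr (mat_powr B (-1/2) * A * mat_powr B (-1/2)) (1 - t) = W * mat_powr C (t - 1) * mat_adjoint W"
    unfolding E mat_powr_unitary_conjugate[OF positive_definite_mat_powr[OF C] W] mat_powr_powr[OF C] by simp
  then have "geometric_mean (1 - t) B A =
      (mat_powr B (1/2) * W) * (mat_powr C (t - 1) * (mat_adjoint W * mat_powr B (1/2)))"
    unfolding geometric_mean_def using c Wc mat_adjoint_carrier[OF Wc] by (simp add: alg)
  also have "\<dots> = geometric_mean t A B"
    unfolding BW WB geometric_mean_def C_def[symmetric] using c by (simp add: alg)
  finally show ?thesis .
qed

section \<open>Log-majorization for the weighted mean\<close>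

text \<open>Each of the three factors of the left matrix is bounded by a power of \<open>y = N\<^sub>k(A\<^sup>2 C)\<close>, with the
  exponents \<open>a\<close>, \<open>b\<close> and \<open>1 - t\<close>. The first factor forces \<open>2a = t + 1/2\<close>; splitting
  \<open>C\<^sup>t = C\<^sup>a C\<^sup>b\<close> and matching the powers of \<open>A\<close> in the middle fixes \<open>b\<close>, and \<open>b \<ge> 0\<close> is the
  hypothesis \<open>t \<ge> 1/2\<close>.\<close>

lemma singular_values_weighted_mean_log_majorized:
  assumes A: "positive_definite n A" and B: "positive_definite n B" and t: "1/2 \<le> t" "t \<le> 1"
  shows "singular_values (mat_powr A t * geometric_mean t A B * mat_powr B (1 - t))
    \<prec>\<^sub>l\<^sub>o\<^sub>g singular_values (mat_powr A (3/2) * B * mat_powr A (-1/2))"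
proof -
  define C where "C = mat_powr A (-1/2) * B * mat_powr A (-1/2)"
  have C: "positive_definite n C" unfolding C_def by (rule positive_definite_sandwich[OF A B])
  note c = mat_powr_carrier[OF A] mat_powr_carrier[OF B] mat_powr_carrier[OF C]
  note Bc = positive_definite_carrier[OF B] and Ac = positive_definite_carrier[OF A] and Cc = positive_definite_carrier[OF C]
  note alg = mat_assoc_square[where n=n] mult_carrier_mat[where n=n]
    mat_powr_add_left[OF A] mat_powr_add[OF A] mat_powr_zero[OF A]
    mat_powr_add_left[OF B] mat_powr_add[OF B] mat_powr_zero[OF B]
    mat_powr_add_left[OF C] mat_powr_add[OF C] mat_powr_zero[OF C]
    left_mult_one_mat[where nr=n and nc=n] right_mult_one_mat[where nr=n and nc=n]
  have BC: "B = mat_powr A (1/2) * C * mat_powr A (1/2)"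
    using sandwich_inverse[OF A B, folded C_def] by simp
  let ?L = "mat_powr A t * geometric_mean t A B * mat_powr B (1 - t)"
  let ?R = "mat_powr A (3/2) * B * mat_powr A (-1/2)"
  define A2 where "A2 = mat_powr A 2"
  have A2: "positive_definite n A2" unfolding A2_def by (rule positive_definite_mat_powr[OF A])
  have R: "?R = A2 * C"
    unfolding A2_def by (subst BC) (use c Cc in \<open>simp add: alg\<close>)
  have Lc: "?L \<in> carrier_mat n n" unfolding geometric_mean_def C_def[symmetric] using c by (simp add: alg)
  have Rc: "?R \<in> carrier_mat n n" using c Bc by (simp add: alg)
  define a where "a = (t + 1/2) / 2"
  define b where "b = (t - 1/2) / 2"
  have ab: "0 \<le> a" "a \<le> 1" "0 \<le> b" "b \<le> 1" "a + b = t" "2 * a = t + 1/2" "2 * b + (1 - t) = 1/2"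
    unfolding a_def b_def using t by (auto simp: field_simps)
  have L: "?L = (mat_powr A (2 * a) * mat_powr C a) * ((mat_powr C b * mat_powr A (2 * b)) * (mat_powr A (1 - t) * mat_powr B (1 - t)))"
    (is "_ = ?F1 * (?F2 * ?F3)")
  proof -
    have "?F1 * (?F2 * ?F3) = mat_powr A (2 * a) * ((mat_powr C a * mat_powr C b) * ((mat_powr A (2 * b) * mat_powr A (1 - t)) * mat_powr B (1 - t)))"
      using c by (simp add: mat_assoc_square[where n=n] mult_carrier_mat[where n=n])
    also have "\<dots> = mat_powr A (t + 1/2) * (mat_powr C t * (mat_powr A (1/2) * mat_powr B (1 - t)))"
      unfolding mat_powr_add[OF A] mat_powr_add[OF C] ab ..
    also have "\<dots> = ?L"
      unfolding geometric_mean_def C_def[symmetric] mat_powr_add[OF A, symmetric]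
      using c by (simp add: mat_assoc_square[where n=n] mult_carrier_mat[where n=n])
    finally show ?thesis ..
  qed
  have le: "top_singular_prod k ?L \<le> top_singular_prod k ?R" if k: "k \<le> n" for k
  proof -
    let ?N = "top_singular_prod k"
    define y where "y = ?N (A2 * C)"
    have y: "0 \<le> y" unfolding y_def R[symmetric] by (rule top_singular_prod_nonneg[OF Rc k])
    have F: "?F1 \<in> carrier_mat n n" "?F2 \<in> carrier_mat n n" "?F3 \<in> carrier_mat n n"
      using c by (simp_all add: mult_carrier_mat[where n=n])
    have cordes: "?N (mat_powr A (2 * r) * mat_powr C r) \<le> y powr r" if "0 \<le> r" "r \<le> 1" for r
      using top_singular_prod_cordes[OF A2 C k that] unfolding y_def A2_def mat_powr_powr[OF A] .
    have N1: "?N ?F1 \<le> y powr a" by (rule cordes[OF ab(1,2)])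
    have N2: "?N ?F2 \<le> y powr b"
    proof -
      have "mat_adjoint (mat_powr A (2 * b) * mat_powr C b) = ?F2"
        unfolding mat_adjoint_mult[OF c(1) c(3)] mat_adjoint_mat_powr[OF A] mat_adjoint_mat_powr[OF C] ..
      then have "?N ?F2 = ?N (mat_powr A (2 * b) * mat_powr C b)"
        using top_singular_prod_adjoint[OF mult_carrier_mat[OF c(1) c(3)] k] by metis
      then show ?thesis using cordes[OF ab(3,4)] by simp
    qed
    have N3: "?N ?F3 \<le> y powr (1 - t)"
    proof -
      have half: "?N (mat_powr A (1/2) * mat_powr B (1/2)) \<le> y powr (1/2)"
      proof -
        \<comment> \<open>\<open>X\<^sup>* X = A\<^bsup>1/2\<^esup> B A\<^bsup>1/2\<^esup>\<close> and \<open>Y\<^sup>* Y = A C A\<close> are the same matrix.\<close>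
        let ?X = "mat_powr B (1/2) * mat_powr A (1/2)"
        let ?Y = "mat_powr C (1/2) * mat_powr A 1"
        have X: "?X \<in> carrier_mat n n" and Y: "?Y \<in> carrier_mat n n"
          using c by (simp_all add: mult_carrier_mat[where n=n])
        have Xa: "mat_adjoint ?X = mat_powr A (1/2) * mat_powr B (1/2)"
          unfolding mat_adjoint_mult[OF c(2) c(1)] mat_adjoint_mat_powr[OF A] mat_adjoint_mat_powr[OF B] ..
        have Ya: "mat_adjoint ?Y = mat_powr A 1 * mat_powr C (1/2)"
          unfolding mat_adjoint_mult[OF c(3) c(1)] mat_adjoint_mat_powr[OF A] mat_adjoint_mat_powr[OF C] ..
        have "mat_adjoint ?X * ?X = mat_powr A (1/2) * (mat_powr B 1 * mat_powr A (1/2))"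
          unfolding Xa using c by (simp add: alg)
        also have "\<dots> = mat_powr A 1 * (mat_powr C 1 * mat_powr A 1)"
          unfolding mat_powr_one[OF B] mat_powr_one[OF C] by (subst BC) (use c Cc in \<open>simp add: alg\<close>)
        also have "\<dots> = mat_adjoint ?Y * ?Y"
          unfolding Ya using c by (simp add: alg)
        finally have "(?N ?X)\<^sup>2 = (?N ?Y)\<^sup>2"
          using top_singular_prod_gram[OF X k] top_singular_prod_gram[OF Y k] by simp
        then have "?N ?X = ?N ?Y"
          using top_singular_prod_nonneg[OF X k] top_singular_prod_nonneg[OF Y k] by simp
        then have "?N (mat_adjoint ?X) = ?N (mat_adjoint ?Y)"
          unfolding top_singular_prod_adjoint[OF X k] top_singular_prod_adjoint[OF Y k] .
        then show ?thesis unfolding Xa Ya using cordes[of "1/2"] by simp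
      qed
      have exponent: "1 / 2 * (2 * (1 - t)) = 1 - t" by simp
      have "?N ?F3 \<le> ?N (mat_powr A (1/2) * mat_powr B (1/2)) powr (2 * (1 - t))"
        using top_singular_prod_cordes[OF positive_definite_mat_powr[OF A, of "1/2"]
            positive_definite_mat_powr[OF B, of "1/2"] k, of "2 * (1 - t)"] t
        unfolding mat_powr_powr[OF A] mat_powr_powr[OF B] exponent by simp
      also have "\<dots> \<le> (y powr (1/2)) powr (2 * (1 - t))"
        using t by (intro powr_mono2 half top_singular_prod_nonneg[OF mult_carrier_mat[OF c(1,2)] k]) auto
      also have "\<dots> = y powr (1 - t)" unfolding powr_powr exponent ..
      finally show ?thesis .
    qed
    have "?N ?L \<le> ?N ?F1 * (?N ?F2 * ?N ?F3)"
      unfolding L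
      by (intro order_trans[OF top_singular_prod_mult_le[OF F(1) mult_carrier_mat[OF F(2,3)] k]]
          mult_left_mono top_singular_prod_mult_le[OF F(2,3) k] top_singular_prod_nonneg[OF F(1) k])
    also have "\<dots> \<le> y powr a * (y powr b * y powr (1 - t))"
      using N1 N2 N3 top_singular_prod_nonneg[OF F(1) k] top_singular_prod_nonneg[OF F(2) k] top_singular_prod_nonneg[OF F(3) k]
      by (intro mult_mono) auto
    also have "\<dots> = y powr (a + (b + (1 - t)))" unfolding powr_add ..
    also have "a + (b + (1 - t)) = 1" using ab(5) by simp
    finally show ?thesis using y unfolding R y_def by simp
  qed
  have "det ?L = det ?R"
  proof -
    obtain \<alpha> where \<alpha>: "0 < \<alpha>" "\<And>r. det (mat_powr A r) = complex_of_real (\<alpha> powr r)"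
      using positive_definite_det_mat_powr[OF A] by metis
    obtain \<beta> where \<beta>: "0 < \<beta>" "\<And>r. det (mat_powr B r) = complex_of_real (\<beta> powr r)"
      using positive_definite_det_mat_powr[OF B] by metis
    obtain \<gamma> where \<gamma>: "0 < \<gamma>" "\<And>r. det (mat_powr C r) = complex_of_real (\<gamma> powr r)"
      using positive_definite_det_mat_powr[OF C] by metis
    have detm: "det (X * Y) = det X * det Y" if "X \<in> carrier_mat n n" "Y \<in> carrier_mat n n" for X Y :: "complex mat"
      using det_mult that by blast
    have "complex_of_real \<beta> = det (mat_powr A (1/2) * mat_powr C 1 * mat_powr A (1/2))"
      unfolding mat_powr_one[OF C] BC[symmetric]
      using \<beta>(2)[of 1] \<beta>(1) by (simp add: mat_powr_one[OF B])
    also have "\<dots> = complex_of_real (\<alpha> powr (1/2) * \<gamma> * \<alpha> powr (1/2))"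
      using c \<gamma>(1) by (simp add: detm mult_carrier_mat[where n=n] \<alpha>(2) \<gamma>(2))
    also have "\<alpha> powr (1/2) * \<gamma> * \<alpha> powr (1/2) = (\<alpha> powr (1/2) * \<alpha> powr (1/2)) * \<gamma>" by simp
    also have "\<dots> = \<alpha> * \<gamma>" unfolding powr_add[symmetric] using \<alpha>(1) by simp
    finally have \<beta>\<gamma>: "\<beta> = \<alpha> * \<gamma>" unfolding of_real_eq_iff .
    have "det ?L = complex_of_real (\<alpha> powr t * (\<alpha> powr (1/2) * \<gamma> powr t * \<alpha> powr (1/2)) * \<beta> powr (1 - t))"
      unfolding geometric_mean_def C_def[symmetric]
      using c by (simp add: detm mult_carrier_mat[where n=n] \<alpha>(2) \<beta>(2) \<gamma>(2))
    also have "\<alpha> powr t * (\<alpha> powr (1/2) * \<gamma> powr t * \<alpha> powr (1/2)) * \<beta> powr (1 - t)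
      = \<alpha> powr (t + 1/2 + 1/2 + (1 - t)) * \<gamma> powr (t + (1 - t))"
      unfolding \<beta>\<gamma> powr_add powr_mult by simp
    also have "\<dots> = \<alpha> powr 2 * \<gamma> powr 1" by simp
    also have "complex_of_real \<dots> = det (A2 * mat_powr C 1)"
      unfolding A2_def using c by (simp add: detm \<alpha>(2) \<gamma>(2))
    finally show ?thesis unfolding R mat_powr_one[OF C] .
  qed
  then show ?thesis
    unfolding log_majorized_singular_values_iff[OF Lc Rc] using le by simp
qed

text \<open>The last exponent is left as \<open>1 - (1 - t)\<close>, so that the right side is literally the matrix for the pair
  \<open>B\<close>, \<open>A\<close> with weight \<open>1 - t\<close>.\<close>

lemma mat_adjoint_weighted_mean:
  assumes A: "positive_definite n A" and B: "positive_definite n B"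
  shows "mat_adjoint (mat_powr A t * geometric_mean t A B * mat_powr B (1 - t)) =
    mat_powr B (1 - t) * geometric_mean (1 - t) B A * mat_powr A (1 - (1 - t))"
proof -
  define C where "C = mat_powr A (-1/2) * B * mat_powr A (-1/2)"
  have C: "positive_definite n C" unfolding C_def by (rule positive_definite_sandwich[OF A B])
  note c = mat_powr_carrier[OF A] mat_powr_carrier[OF B] mat_powr_carrier[OF C]
  note adj = mat_adjoint_mat_powr[OF A] mat_adjoint_mat_powr[OF B] mat_adjoint_mat_powr[OF C]
  have G: "geometric_mean t A B = mat_powr A (1/2) * (mat_powr C t * mat_powr A (1/2))"
    unfolding geometric_mean_def C_def[symmetric] using c by (simp add: mat_assoc_square[where n=n])
  have Gc: "geometric_mean t A B \<in> carrier_mat n n" unfolding G using c by (simp add: mult_carrier_mat[where n=n])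
  have Gadj: "mat_adjoint (geometric_mean t A B) = geometric_mean t A B"
    unfolding G mat_adjoint_mult[OF c(1) mult_carrier_mat[OF c(3) c(1)]] mat_adjoint_mult[OF c(3) c(1)] adj
    using c by (simp add: mat_assoc_square[where n=n])
  show ?thesis
    unfolding geometric_mean_swap[OF A B] mat_adjoint_mult[OF mult_carrier_mat[OF c(1) Gc] c(2)]
      mat_adjoint_mult[OF c(1) Gc] Gadj adj
    using c Gc by (simp add: mat_assoc_square[where n=n])
qed

theorem theorem3p3:
  fixes n :: nat and A B :: "complex mat"
  assumes "positive_definite n A" and "positive_definite n B"
  shows "(\<forall>t::real. 1/2 \<le> t \<and> t \<le> 1 \<longrightarrow>
            singular_values (mat_powr A t * geometric_mean t A B * mat_powr B (1 - t))
              \<prec>\<^sub>l\<^sub>o\<^sub>g singular_values (mat_powr A (3/2) * B * mat_powr A (-1/2))) \<and>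
         (\<forall>t::real. 0 \<le> t \<and> t \<le> 1/2 \<longrightarrow>
            singular_values (mat_powr A t * geometric_mean t A B * mat_powr B (1 - t))
              \<prec>\<^sub>l\<^sub>o\<^sub>g singular_values (mat_powr B (3/2) * A * mat_powr B (-1/2)))"
proof (intro conjI allI impI; elim conjE)
  fix t :: real assume "1/2 \<le> t" "t \<le> 1"
  then show "singular_values (mat_powr A t * geometric_mean t A B * mat_powr B (1 - t))
              \<prec>\<^sub>l\<^sub>o\<^sub>g singular_values (mat_powr A (3/2) * B * mat_powr A (-1/2))"
    by (rule singular_values_weighted_mean_log_majorized[OF assms])
next
  note A = assms(1) and B = assms(2)
  fix t :: real assume t: "0 \<le> t" "t \<le> 1/2"
  let ?L = "mat_powr A t * geometric_mean t A B * mat_powr B (1 - t)"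
  let ?R = "mat_powr B (3/2) * A * mat_powr B (-1/2)"
  note c = mat_powr_carrier[OF A] mat_powr_carrier[OF B] positive_definite_carrier[OF A]
    mat_powr_carrier[OF positive_definite_sandwich[OF A B]]
  have Lc: "?L \<in> carrier_mat n n" and Rc: "?R \<in> carrier_mat n n"
    unfolding geometric_mean_def using c by (simp_all add: mult_carrier_mat[where n=n])
  have "singular_values (mat_adjoint ?L) \<prec>\<^sub>l\<^sub>o\<^sub>g singular_values ?R"
    unfolding mat_adjoint_weighted_mean[OF A B]
    by (rule singular_values_weighted_mean_log_majorized[OF B A]) (use t in auto)
  then show "singular_values ?L \<prec>\<^sub>l\<^sub>o\<^sub>g singular_values ?R"
    unfolding log_majorized_singular_values_iff[OF mat_adjoint_carrier[OF Lc] Rc]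
      log_majorized_singular_values_iff[OF Lc Rc] det_mat_adjoint[OF Lc]
    by (simp add: top_singular_prod_adjoint[OF Lc])
qed

end
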